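(* Let $\eta=\min(\alpha-1,\beta,\gamma)$, $\mu\in(0,\eta)$ and $C_{\rm i}>0$. There exist positive constants $\varepsilon_0=\varepsilon_0(\mu,C_{\rm i})$, $C_{\rm l}=C_{\rm l}(C_{\rm i})$ and $\nu$ (each depending on $\mu,C_{\rm i}$ only through the indicated arguments; $\nu$ is independent of both) such that the following holds. For any $X^\ast=(x^\ast,y^\ast)^T\in\ell_2^2$ such that $0<\varepsilon:=\|X^\ast\|_2\le\varepsilon_0$, consider the solution $A\in C^2(\mathbb R,\ell_2(\mathbb Z,\mathbb C))$ of the amplitude equation $i\,\dot A=\delta^+f(\delta^-A)$ with initial condition $A(0)=(x^\ast-i\,y^\ast)/\sqrt2$, and define $$X_A(t)=\frac1{\sqrt2}A(t)\,e^{it}\begin{pmatrix}1\\ i\end{pmatrix}+\mathrm{c.c.}$$ Then for all $X^0\in\ell_2^2$ satisfying $\|X^0-X^\ast\|_2\le C_{\rm i}\,|\ln\varepsilon|\,\varepsilon^{1+\eta}$, the solution $X(t)\in\ell_2^2$ of $\dot X=JX+G(X)$ with $X(0)=X^0$ is defined for $t\in[0,\mu\,\nu\,|\ln\varepsilon|\,\varepsilon^{1-\alpha}]$ and satisfies $$\|X(t)-X_A(t)\|_2\le C_{\rm l}\,|\ln\varepsilon|\,\varepsilon^{1+\eta-\mu},\qquad t\in[0,\mu\,\nu\,|\ln\varepsilon|\,\varepsilon^{1-\alpha}].$$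
   Context: **Lattice model.** Fix $\alpha>1$, real $(k_-,k_+)\ne(0,0)$ and $\beta,\gamma>0$. Let $V\in C^2(\mathbb R,\mathbb R)$, $V=V_\alpha+W$, where $V_\alpha(r)=\frac{k_-}{1+\alpha}|r|^{\alpha+1}$ for $r\le0$, $V_\alpha(r)=\frac{k_+}{1+\alpha}r^{\alpha+1}$ for $r\ge0$, and $W'(0)=0$, $W''(r)=O(|r|^{\alpha-1+\beta})$ as $r\to0$. Let $\phi\in C^2(\mathbb R,\mathbb R)$ with $\phi'(0)=0$, $\phi''(x)=O(|x|^{\alpha-1+\gamma})$ as $x\to0$. For sequences, $(\delta^+x)_n=x_{n+1}-x_n$, $(\delta^-x)_n=x_n-x_{n-1}$, and scalar functions act componentwise. Set $F(x)=\delta^+V'(\delta^-x)-\phi'(x)$. The lattice $\ddot x_n+x_n=F(x)_n$, $n\in\mathbb Z$, is written for $X=(x,\dot x)^T\in\ell_2^2=\ell_2(\mathbb Z,\mathbb R)^2$ as $\dot X=JX+G(X)$, with $J=\begin{pmatrix}0&\mathrm{Id}\\-\mathrm{Id}&0\end{pmatrix}$ and $G(X_1,X_2)=(0,F(X_1))^T$. Norm on $\ell_2^2$: for $X=(x,y)^T$, $\|X\|_2=\big(\sum_n(x_n^2+y_n^2)\big)^{1/2}$. **Amplitude equation.** For $a\in\ell_2(\mathbb Z,\mathbb C)$, $(f(a))_n=\omega_0\,a_n|a_n|^{\alpha-1}$ with $$\omega_0=(k_-+k_+)\,2^{\frac{\alpha-3}{2}}\,\frac{\alpha\,\Gamma(\alpha/2)}{\sqrt\pi\,(\alpha+1)\,\Gamma((\alpha+1)/2)}.$$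 Its Cauchy problem in $\ell_2(\mathbb Z,\mathbb C)$ is globally well-posed. **Notation.** "c.c." is the complex conjugate of the preceding term; for $a\in\ell_2(\mathbb Z,\mathbb C)$ and $(z_1,z_2)^T\in\mathbb C^2$, $a\,(z_1,z_2)^T$ is the pair of sequences $(z_1a,z_2a)^T$. The constants may in addition depend on the model data $(\alpha,k_\pm,W,\phi,\beta,\gamma)$. *)

theory Defs
  imports "HOL-Analysis.Analysis" "HOL-Library.Landau_Symbols"
begin

section \<open>The Hilbert space of square-summable sequences indexed by the integers\<close>

definition square_summable :: "(int \<Rightarrow> 'a::real_inner) \<Rightarrow> bool" where
  "square_summable x \<longleftrightarrow> (\<lambda>n. (norm (x n))\<^sup>2) summable_on UNIV"

lemma square_summable_zero: "square_summable (\<lambda>n. 0)"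
  by (simp add: square_summable_def)

lemma square_summable_scaleR:
  assumes "square_summable x"
  shows "square_summable (\<lambda>n. r *\<^sub>R x n)"
  using assms unfolding square_summable_def
  by (simp add: power_mult_distrib summable_on_cmult_right)

lemma square_summable_add:
  assumes "square_summable x" "square_summable y"
  shows "square_summable (\<lambda>n. x n + y n)"
  unfolding square_summable_def
proof (rule summable_on_comparison_test)
  show "(\<lambda>n. 2 * (norm (x n))\<^sup>2 + 2 * (norm (y n))\<^sup>2) summable_on UNIV"
    using assms unfolding square_summable_def
    by (intro summable_on_add summable_on_cmult_right)
  fix n
  have "(norm (x n + y n))\<^sup>2 \<le> (norm (x n) + norm (y n))\<^sup>2"
    by (intro power_mono norm_triangle_ineq) simp
  also have "\<dots> \<le> 2 * (norm (x n))\<^sup>2 + 2 * (norm (y n))\<^sup>2"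
    using zero_le_power2[of "norm (x n) - norm (y n)"]
    by (simp add: power2_eq_square algebra_simps)
  finally show "(norm (x n + y n))\<^sup>2 \<le> 2 * (norm (x n))\<^sup>2 + 2 * (norm (y n))\<^sup>2" .
qed auto

lemma square_summable_uminus:
  "square_summable x \<Longrightarrow> square_summable (\<lambda>n. - x n)"
  by (simp add: square_summable_def)

lemma square_summable_diff:
  assumes "square_summable x" "square_summable y"
  shows "square_summable (\<lambda>n. x n - y n)"
  using square_summable_add[OF assms(1) square_summable_uminus[OF assms(2)]] by simp

lemma square_summable_shift:
  assumes "square_summable x"
  shows "square_summable (\<lambda>n. x (n + k))"
proof -
  have "bij_betw (\<lambda>n. n + k) UNIV (UNIV :: int set)"
    by (rule bij_betwI[where g = "\<lambda>n. n - k"]) auto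
  from summable_on_reindex_bij_betw[OF this, of "\<lambda>n. (norm (x n))\<^sup>2"] assms
  show ?thesis by (simp add: square_summable_def)
qed

lemma square_summable_inner:
  assumes "square_summable x" "square_summable y"
  shows "(\<lambda>n. x n \<bullet> y n) summable_on UNIV"
proof -
  have "(\<lambda>n. (x n + y n) \<bullet> (x n + y n)) summable_on UNIV"
    "(\<lambda>n. x n \<bullet> x n) summable_on UNIV" "(\<lambda>n. y n \<bullet> y n) summable_on UNIV"
    using square_summable_add[OF assms] assms
    by (simp_all add: square_summable_def power2_norm_eq_inner)
  hence "(\<lambda>n. (1/2) * ((x n + y n) \<bullet> (x n + y n) + (-1) * (x n \<bullet> x n) + (-1) * (y n \<bullet> y n)))
      summable_on UNIV"
    by (intro summable_on_add summable_on_cmult_right)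
  moreover have "(1/2) * ((x n + y n) \<bullet> (x n + y n) + (-1) * (x n \<bullet> x n) + (-1) * (y n \<bullet> y n))
      = x n \<bullet> y n" for n
    by (simp add: inner_add_left inner_add_right inner_commute)
  ultimately show ?thesis by simp
qed

typedef (overloaded) ('a::real_inner) ell2 = "{x :: int \<Rightarrow> 'a. square_summable x}"
  morphisms ell2_nth Abs_ell2
  using square_summable_zero by blast

setup_lifting type_definition_ell2

lemma ell2_eqI: "(\<And>n. ell2_nth x n = ell2_nth y n) \<Longrightarrow> x = y"
  by (metis ell2_nth_inject ext)

lemma square_summable_ell2_nth: "square_summable (ell2_nth x)"
  using ell2_nth by blast

instantiation ell2 :: (real_inner) real_inner
begin

lift_definition zero_ell2 :: "'a ell2" is "\<lambda>n. 0"
  by (rule square_summable_zero)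

lift_definition plus_ell2 :: "'a ell2 \<Rightarrow> 'a ell2 \<Rightarrow> 'a ell2" is "\<lambda>x y n. x n + y n"
  by (rule square_summable_add)

lift_definition minus_ell2 :: "'a ell2 \<Rightarrow> 'a ell2 \<Rightarrow> 'a ell2" is "\<lambda>x y n. x n - y n"
  by (rule square_summable_diff)

lift_definition uminus_ell2 :: "'a ell2 \<Rightarrow> 'a ell2" is "\<lambda>x n. - x n"
  by (rule square_summable_uminus)

lift_definition scaleR_ell2 :: "real \<Rightarrow> 'a ell2 \<Rightarrow> 'a ell2" is "\<lambda>r x n. r *\<^sub>R x n"
  by (rule square_summable_scaleR)

definition inner_ell2 :: "'a ell2 \<Rightarrow> 'a ell2 \<Rightarrow> real" where
  "inner_ell2 x y = (\<Sum>\<^sub>\<infinity>n. ell2_nth x n \<bullet> ell2_nth y n)"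

definition norm_ell2 :: "'a ell2 \<Rightarrow> real" where
  "norm_ell2 x = sqrt (\<Sum>\<^sub>\<infinity>n. (norm (ell2_nth x n))\<^sup>2)"

definition sgn_ell2 :: "'a ell2 \<Rightarrow> 'a ell2" where
  "sgn_ell2 x = inverse (norm x) *\<^sub>R x"

definition dist_ell2 :: "'a ell2 \<Rightarrow> 'a ell2 \<Rightarrow> real" where
  "dist_ell2 x y = norm (x - y)"

definition uniformity_ell2 :: "('a ell2 \<times> 'a ell2) filter" where
  "uniformity_ell2 = (INF e\<in>{0<..}. principal {(x, y). dist x y < e})"

definition open_ell2 :: "'a ell2 set \<Rightarrow> bool" where
  "open_ell2 U \<longleftrightarrow> (\<forall>x\<in>U. \<forall>\<^sub>F (x', y) in uniformity. x' = x \<longrightarrow> y \<in> U)"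

instance
proof
  fix x y z :: "'a ell2" and r s :: real
  show "x + y + z = x + (y + z)" "x + y = y + x" "0 + x = x" "- x + x = 0" "x - y = x + - y"
    "r *\<^sub>R (x + y) = r *\<^sub>R x + r *\<^sub>R y" "(r + s) *\<^sub>R x = r *\<^sub>R x + s *\<^sub>R x"
    "r *\<^sub>R s *\<^sub>R x = (r * s) *\<^sub>R x" "1 *\<^sub>R x = x"
    by (transfer; simp add: algebra_simps)+
  show "sgn x = inverse (norm x) *\<^sub>R x" by (rule sgn_ell2_def)
  show "dist x y = norm (x - y)" by (rule dist_ell2_def)
  show "(uniformity :: ('a ell2 \<times> 'a ell2) filter) = (INF e\<in>{0<..}. principal {(x, y). dist x y < e})"
    by (rule uniformity_ell2_def)
  show "open U \<longleftrightarrow> (\<forall>x\<in>U. \<forall>\<^sub>F (x', y) in uniformity. x' = x \<longrightarrow> y \<in> U)" for U :: "'a ell2 set"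
    by (rule open_ell2_def)
  note S = square_summable_inner[OF square_summable_ell2_nth square_summable_ell2_nth]
  show "inner x y = inner y x"
    by (simp add: inner_ell2_def inner_commute)
  show "inner (x + y) z = inner x z + inner y z"
    unfolding inner_ell2_def plus_ell2.rep_eq inner_add_left by (rule infsum_add[OF S S])
  show "inner (r *\<^sub>R x) y = r * inner x y"
    unfolding inner_ell2_def scaleR_ell2.rep_eq inner_scaleR_left by (rule infsum_cmult_right[OF S])
  show "0 \<le> inner x x"
    unfolding inner_ell2_def by (rule infsum_nonneg) simp
  show "inner x x = 0 \<longleftrightarrow> x = 0"
  proof
    assume "inner x x = 0"
    hence "ell2_nth x n \<bullet> ell2_nth x n = 0" for n
      using nonneg_infsum_le_0D[OF _ S[of x x], of n] by (simp add: inner_ell2_def)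
    thus "x = 0"
      by (intro ell2_eqI) (simp add: zero_ell2.rep_eq)
  qed (simp add: inner_ell2_def zero_ell2.rep_eq)
  show "norm x = sqrt (inner x x)"
    by (simp add: norm_ell2_def inner_ell2_def power2_norm_eq_inner)
qed

end

lift_definition delta_plus :: "'a::real_inner ell2 \<Rightarrow> 'a ell2" is "\<lambda>x n. x (n + 1) - x n"
  by (intro square_summable_diff square_summable_shift)

lift_definition delta_minus :: "'a::real_inner ell2 \<Rightarrow> 'a ell2" is "\<lambda>x n. x n - x (n - 1)"
  subgoal for x using square_summable_diff[OF _ square_summable_shift[of x "-1"], of x] by simp
  done

text \<open>
  Componentwise action of a scalar function.  The result is meaningful only if the image
  sequence is square-summable; by \<open>ell2_nth_map\<close> this is the case for every function that is
  bounded by a multiple of the norm near the origin, in particular for all functions to which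
  \<open>ell2_map\<close> is applied below.
\<close>

definition ell2_map :: "('a::real_inner \<Rightarrow> 'b::real_inner) \<Rightarrow> 'a ell2 \<Rightarrow> 'b ell2" where
  "ell2_map g x = Abs_ell2 (\<lambda>n. g (ell2_nth x n))"

lemma square_summable_finite_large:
  assumes "square_summable x" "d > 0"
  shows "finite {n. d \<le> norm (x n)}"
proof (rule ccontr)
  assume inf: "infinite {n. d \<le> norm (x n)}"
  define S where "S = (\<Sum>\<^sub>\<infinity>n. (norm (x n))\<^sup>2)"
  obtain k :: nat where k: "real k * d\<^sup>2 > S"
    using reals_Archimedean3[of "d\<^sup>2"] assms(2) by auto
  obtain B where B: "B \<subseteq> {n. d \<le> norm (x n)}" "finite B" "card B = k"
    using infinite_arbitrarily_large[OF inf] by metis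
  have "real k * d\<^sup>2 = (\<Sum>n\<in>B. d\<^sup>2)"
    using B by simp
  also have "\<dots> \<le> (\<Sum>n\<in>B. (norm (x n))\<^sup>2)"
    using B assms(2) by (intro sum_mono power_mono) auto
  also have "\<dots> \<le> S"
    unfolding S_def using assms(1) B(2)
    by (intro finite_sum_le_infsum) (auto simp: square_summable_def)
  finally show False using k by simp
qed

lemma square_summable_comp:
  assumes x: "square_summable x"
    and g: "\<forall>\<^sub>F z in nhds 0. norm (g z) \<le> C * norm z"
  shows "square_summable (\<lambda>n. g (x n))"
proof -
  from g obtain d where d: "d > 0" "\<And>z. norm z < d \<Longrightarrow> norm (g z) \<le> C * norm z"
    unfolding eventually_nhds_metric by auto
  let ?L = "{n. d \<le> norm (x n)}"
  have "(\<lambda>n. (norm (g (x n)))\<^sup>2) summable_on (UNIV - ?L)"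
  proof (rule summable_on_comparison_test)
    show "(\<lambda>n. C\<^sup>2 * (norm (x n))\<^sup>2) summable_on (UNIV - ?L)"
      using x unfolding square_summable_def
      by (intro summable_on_cmult_right) (rule summable_on_subset_banach, auto)
    fix n assume "n \<in> UNIV - ?L"
    hence "norm (g (x n)) \<le> C * norm (x n)" using d by auto
    from power_mono[OF this, of 2] show "(norm (g (x n)))\<^sup>2 \<le> C\<^sup>2 * (norm (x n))\<^sup>2"
      by (simp add: power_mult_distrib)
  qed auto
  moreover have "(\<lambda>n. (norm (g (x n)))\<^sup>2) summable_on ?L"
    by (rule summable_on_finite[OF square_summable_finite_large[OF x d(1)]])
  ultimately have "(\<lambda>n. (norm (g (x n)))\<^sup>2) summable_on ((UNIV - ?L) \<union> ?L)"
    by (intro summable_on_Un_disjoint) auto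
  thus ?thesis unfolding square_summable_def by (simp add: Un_commute)
qed

lemma ell2_nth_map:
  assumes "\<forall>\<^sub>F z in nhds 0. norm (g z) \<le> C * norm z"
  shows "ell2_nth (ell2_map g x) n = g (ell2_nth x n)"
  using square_summable_comp[OF square_summable_ell2_nth assms]
  by (simp add: ell2_map_def Abs_ell2_inverse)

lemma ell2_nth_map_differentiable:
  fixes g :: "real \<Rightarrow> real"
  assumes "g 0 = 0" "(g has_real_derivative D) (at 0)"
  shows "ell2_nth (ell2_map g x) n = g (ell2_nth x n)"
proof (rule ell2_nth_map)
  have "((\<lambda>z. g z / z) \<longlongrightarrow> D) (at 0)"
    using assms unfolding has_field_derivative_iff by simp
  hence "\<forall>\<^sub>F z in at 0. dist (g z / z) D < 1"
    by (rule tendstoD) simp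
  hence "\<forall>\<^sub>F z in at 0. norm (g z) \<le> (\<bar>D\<bar> + 1) * norm z"
  proof eventually_elim
    case (elim z)
    hence "\<bar>g z / z\<bar> \<le> \<bar>D\<bar> + 1" by (simp add: dist_real_def)
    thus ?case by (cases "z = 0") (auto simp: abs_divide divide_simps assms(1) split: if_splits)
  qed
  thus "\<forall>\<^sub>F z in nhds 0. norm (g z) \<le> (\<bar>D\<bar> + 1) * norm z"
    unfolding eventually_at_filter by eventually_elim (use assms in auto)
qed

section \<open>Twice continuously differentiable functions of a real variable\<close>

definition C2 :: "(real \<Rightarrow> 'a::real_normed_vector) \<Rightarrow> bool" where
  "C2 u \<longleftrightarrow> (\<exists>u'. (\<forall>t. (u has_vector_derivative u' t) (at t)) \<and> u' C1_differentiable_on UNIV)"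

lemma C2_realD:
  fixes u :: "real \<Rightarrow> real"
  assumes "C2 u"
  shows "(u has_real_derivative deriv u t) (at t)"
    and "(deriv u has_real_derivative deriv (deriv u) t) (at t)"
    and "continuous_on UNIV (deriv (deriv u))"
proof -
  obtain u' u'' where u: "\<And>t. (u has_real_derivative u' t) (at t)"
    "\<And>t. (u' has_real_derivative u'' t) (at t)" "continuous_on UNIV u''"
    using assms unfolding C2_def C1_differentiable_on_def
    by (auto simp: has_real_derivative_iff_has_vector_derivative)
  have "deriv u = u'" "deriv u' = u''" using u by (auto intro!: DERIV_imp_deriv)
  thus "(u has_real_derivative deriv u t) (at t)"
    and "(deriv u has_real_derivative deriv (deriv u) t) (at t)"
    and "continuous_on UNIV (deriv (deriv u))" using u by auto
qed

section \<open>The lattice\<close>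

definition V_hom :: "real \<Rightarrow> real \<Rightarrow> real \<Rightarrow> real \<Rightarrow> real" where
  "V_hom \<alpha> km kp r =
     (if r \<le> 0 then km / (1 + \<alpha>) * \<bar>r\<bar> powr (\<alpha> + 1) else kp / (1 + \<alpha>) * r powr (\<alpha> + 1))"

lemma V_hom_derivative_0:
  assumes "\<alpha> > 1"
  shows "(V_hom \<alpha> km kp has_real_derivative 0) (at 0)"
proof -
  let ?K = "\<bar>km / (1 + \<alpha>)\<bar> + \<bar>kp / (1 + \<alpha>)\<bar>"
  have "((\<lambda>r. ?K * \<bar>r\<bar> powr \<alpha>) \<longlongrightarrow> ?K * \<bar>0\<bar> powr \<alpha>) (at (0::real))"
    using assms by (intro tendsto_intros) auto
  hence lim: "((\<lambda>r::real. ?K * \<bar>r\<bar> powr \<alpha>) \<longlongrightarrow> 0) (at 0)"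
    using assms by simp
  have bound: "norm (V_hom \<alpha> km kp r / r) \<le> ?K * \<bar>r\<bar> powr \<alpha>" if "r \<noteq> 0" for r
  proof -
    have "\<bar>V_hom \<alpha> km kp r\<bar> \<le> ?K * \<bar>r\<bar> powr (\<alpha> + 1)"
      by (auto simp: V_hom_def abs_mult distrib_right)
    also have "\<dots> = ?K * \<bar>r\<bar> powr \<alpha> * \<bar>r\<bar>"
      using that by (simp add: powr_add)
    finally show ?thesis using that by (simp add: abs_divide divide_le_eq)
  qed
  have "((\<lambda>r. V_hom \<alpha> km kp r / r) \<longlongrightarrow> 0) (at 0)"
    by (rule Lim_null_comparison[OF _ lim])
      (use bound in \<open>auto simp: eventually_at_filter\<close>)
  thus ?thesis by (simp add: has_field_derivative_iff V_hom_def)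
qed

lemma deriv_potential_0:
  assumes "\<alpha> > 1" "C2 V" "\<And>r. V r = V_hom \<alpha> km kp r + W r" "deriv W 0 = 0"
  shows "deriv V 0 = 0"
proof -
  have "((\<lambda>r. V r - V_hom \<alpha> km kp r) has_real_derivative deriv V 0 - 0) (at 0)"
    by (rule DERIV_diff[OF C2_realD(1)[OF assms(2)] V_hom_derivative_0[OF assms(1)]])
  moreover have "(\<lambda>r. V r - V_hom \<alpha> km kp r) = W" using assms(3) by auto
  ultimately show ?thesis using assms(4) DERIV_imp_deriv by fastforce
qed

definition lattice_F :: "(real \<Rightarrow> real) \<Rightarrow> (real \<Rightarrow> real) \<Rightarrow> real ell2 \<Rightarrow> real ell2" where
  "lattice_F V \<phi> x = delta_plus (ell2_map (deriv V) (delta_minus x)) - ell2_map (deriv \<phi>) x"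

lemma ell2_nth_lattice_F:
  assumes "C2 V" "deriv V 0 = 0" "C2 \<phi>" "deriv \<phi> 0 = 0"
  shows "ell2_nth (lattice_F V \<phi> x) n =
    deriv V (ell2_nth x (n + 1) - ell2_nth x n) - deriv V (ell2_nth x n - ell2_nth x (n - 1))
      - deriv \<phi> (ell2_nth x n)"
  using ell2_nth_map_differentiable[OF assms(2) C2_realD(2)[OF assms(1)]]
    ell2_nth_map_differentiable[OF assms(4) C2_realD(2)[OF assms(3)]]
  by (simp add: lattice_F_def minus_ell2.rep_eq delta_plus.rep_eq delta_minus.rep_eq)

text \<open>
  The norm on the product type \<open>real ell2 \<times> real ell2\<close> is the square root of the sum of the
  squared norms of the two components, as required.
\<close>

definition lattice_J :: "real ell2 \<times> real ell2 \<Rightarrow> real ell2 \<times> real ell2" where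
  "lattice_J X = (snd X, - fst X)"

definition lattice_G ::
  "(real \<Rightarrow> real) \<Rightarrow> (real \<Rightarrow> real) \<Rightarrow> real ell2 \<times> real ell2 \<Rightarrow> real ell2 \<times> real ell2" where
  "lattice_G V \<phi> X = (0, lattice_F V \<phi> (fst X))"

definition lattice_solution ::
  "(real \<Rightarrow> real) \<Rightarrow> (real \<Rightarrow> real) \<Rightarrow> real \<Rightarrow> real ell2 \<times> real ell2
    \<Rightarrow> (real \<Rightarrow> real ell2 \<times> real ell2) \<Rightarrow> bool" where
  "lattice_solution V \<phi> T X0 X \<longleftrightarrow> X 0 = X0 \<and>
     (\<forall>t\<in>{0..T}. (X has_vector_derivative lattice_J (X t) + lattice_G V \<phi> (X t)) (at t within {0..T}))"

section \<open>The amplitude equation\<close>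

definition omega0 :: "real \<Rightarrow> real \<Rightarrow> real \<Rightarrow> real" where
  "omega0 \<alpha> km kp = (km + kp) * 2 powr ((\<alpha> - 3) / 2) *
     (\<alpha> * Gamma (\<alpha> / 2) / (sqrt pi * (\<alpha> + 1) * Gamma ((\<alpha> + 1) / 2)))"

definition amplitude_f :: "real \<Rightarrow> real \<Rightarrow> real \<Rightarrow> complex ell2 \<Rightarrow> complex ell2" where
  "amplitude_f \<alpha> km kp a =
     ell2_map (\<lambda>z. complex_of_real (omega0 \<alpha> km kp) * z * complex_of_real (cmod z powr (\<alpha> - 1))) a"

lemma ell2_nth_amplitude_f:
  assumes "\<alpha> > 1"
  shows "ell2_nth (amplitude_f \<alpha> km kp a) n =
    complex_of_real (omega0 \<alpha> km kp) * ell2_nth a n * complex_of_real (cmod (ell2_nth a n) powr (\<alpha> - 1))"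
  unfolding amplitude_f_def
proof (rule ell2_nth_map)
  have "\<forall>\<^sub>F z :: complex in nhds 0. norm z < 1"
    unfolding eventually_nhds_metric by (auto intro!: exI[of _ 1])
  thus "\<forall>\<^sub>F z in nhds 0.
      norm (complex_of_real (omega0 \<alpha> km kp) * z * complex_of_real (cmod z powr (\<alpha> - 1)))
        \<le> \<bar>omega0 \<alpha> km kp\<bar> * norm z"
  proof eventually_elim
    case (elim z)
    have "cmod z powr (\<alpha> - 1) \<le> 1" using elim assms by (intro powr_le1) auto
    thus ?case by (simp add: norm_mult mult_left_le)
  qed
qed

definition cscale :: "complex \<Rightarrow> complex ell2 \<Rightarrow> complex ell2" where
  "cscale c a = ell2_map (\<lambda>z. c * z) a"

lemma ell2_nth_cscale: "ell2_nth (cscale c a) n = c * ell2_nth a n"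
  unfolding cscale_def
  by (rule ell2_nth_map[where C = "cmod c"]) (simp add: norm_mult)

definition amplitude_solution ::
  "real \<Rightarrow> real \<Rightarrow> real \<Rightarrow> (real \<Rightarrow> complex ell2) \<Rightarrow> bool" where
  "amplitude_solution \<alpha> km kp A \<longleftrightarrow> C2 A \<and>
     (\<forall>t. cscale \<i> (vector_derivative A (at t)) =
        delta_plus (amplitude_f \<alpha> km kp (delta_minus (A t))))"

text \<open>
  The sum of a complex sequence and its complex conjugate, as a real sequence.
\<close>

definition plus_cc :: "complex ell2 \<Rightarrow> real ell2" where
  "plus_cc a = ell2_map (\<lambda>z. Re (z + cnj z)) a"

lemma ell2_nth_plus_cc:
  "complex_of_real (ell2_nth (plus_cc a) n) = ell2_nth a n + cnj (ell2_nth a n)"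
proof -
  have "ell2_nth (plus_cc a) n = Re (ell2_nth a n + cnj (ell2_nth a n))"
    unfolding plus_cc_def
    by (rule ell2_nth_map[where C = 2]) (rule always_eventually, simp add: abs_mult abs_Re_le_cmod)
  thus ?thesis by (simp add: complex_eq_iff)
qed

definition X_approx :: "(real \<Rightarrow> complex ell2) \<Rightarrow> real \<Rightarrow> real ell2 \<times> real ell2" where
  "X_approx A t =
     (let a = cscale (complex_of_real (1 / sqrt 2) * exp (\<i> * complex_of_real t)) (A t)
      in (plus_cc (cscale 1 a), plus_cc (cscale \<i> a)))"

end

theory Submission
  imports Defs
begin

text \<open>
  In the frame rotating with the linear flow, a solution \<open>X\<close> of the lattice becomes
  \<open>Y t = rot (- t) (X t)\<close>, which moves only under the nonlinear force and therefore slowly: on a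
  ball of radius of order \<open>\<epsilon>\<close> the vector field has size of order \<open>\<epsilon> powr \<alpha>\<close> and Lipschitz constant of
  order \<open>\<epsilon> powr (\<alpha> - 1)\<close>. Its leading part comes from the homogeneous potential and is periodic in
  time with period \<open>2 * pi\<close>. The mean of this leading part over a period is exactly the vector field of
  the amplitude equation, up to the linear change of variables \<open>demod\<close> between a complex amplitude and
  a pair of real sequences (\<open>demod_amplitude_derivative\<close>). For a single bond the mean is computed
  with polar coordinates, and the constant \<open>omega0\<close> appears as the value of the Beta integral for
  \<open>\<integral> cos powr (\<alpha> + 1)\<close> (\<open>integral_force_hom\<close>, \<open>omega0_conv_Beta\<close>). In these terms
  \<open>X_approx A t\<close> is \<open>rot t (P t)\<close> with \<open>P t = demod (A t)\<close>, so that \<open>X - X_approx\<close> has the norm of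
  \<open>Y - P\<close>. The amplitude equation conserves the norm, hence \<open>P\<close> stays on the sphere of radius \<open>\<epsilon>\<close>
  (\<open>amplitude_norm_conserved\<close>).

  The difference \<open>Y - P\<close> is controlled by Gronwall's inequality. The defect of \<open>P\<close> as a solution of the
  equation for \<open>Y\<close> has two parts. The corrections \<open>W\<close> and \<open>\<phi>\<close> contribute at most a multiple of
  \<open>\<epsilon> powr (\<alpha> + min \<beta> \<gamma>)\<close> per unit of time. The oscillating part has mean zero for frozen \<open>P\<close>, and \<open>P\<close>
  moves by at most a multiple of \<open>\<epsilon> powr \<alpha>\<close> during a period, so its integral over a time \<open>t\<close> is
  of order \<open>\<epsilon> powr \<alpha> + t * \<epsilon> powr (2 * \<alpha> - 1)\<close> (\<open>averaged_integral_bound\<close>). For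
  \<open>t \<le> T = \<mu> * \<nu> * \<bar>ln \<epsilon>\<bar> * \<epsilon> powr (1 - \<alpha>)\<close> everything together is of order \<open>\<bar>ln \<epsilon>\<bar> * \<epsilon> powr (1 + \<eta>)\<close>,
  as is the initial error. The Gronwall factor is \<open>exp (K * T)\<close> with \<open>K\<close> of order \<open>\<epsilon> powr (\<alpha> - 1)\<close>;
  choosing \<open>\<nu>\<close> as the reciprocal of the constant in \<open>K\<close> makes it exactly \<open>\<epsilon> powr (- \<mu>)\<close>
  (\<open>shadowing_error_bound\<close>).

  The bound on \<open>Y\<close> that this argument presupposes comes from truncation. The vector field is
  composed with the radial retraction \<open>cap_norm\<close> onto the ball of radius \<open>2 * \<epsilon>\<close>, which makes it
  globally Lipschitz and leaves it unchanged near \<open>P\<close>. The solution of the modified equation exists on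
  the whole time interval, the estimate places it within distance \<open>\<epsilon>\<close> of \<open>P\<close>, hence inside the ball, and there it
  solves the lattice equation (\<open>lattice_shadows_averaged\<close>).
\<close>

section \<open>The sequence space as a Hilbert space\<close>

lemma ell2_nth_simps [simp]:
  "ell2_nth 0 n = 0" "ell2_nth (x + y) n = ell2_nth x n + ell2_nth y n"
  "ell2_nth (x - y) n = ell2_nth x n - ell2_nth y n" "ell2_nth (- x) n = - ell2_nth x n"
  "ell2_nth (r *\<^sub>R x) n = r *\<^sub>R ell2_nth x n"
  "ell2_nth (delta_plus x) n = ell2_nth x (n + 1) - ell2_nth x n"
  "ell2_nth (delta_minus x) n = ell2_nth x n - ell2_nth x (n - 1)"
  by (simp_all add: zero_ell2.rep_eq plus_ell2.rep_eq minus_ell2.rep_eq uminus_ell2.rep_eq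
      scaleR_ell2.rep_eq delta_plus.rep_eq delta_minus.rep_eq)

lemma summable_ell2: "(\<lambda>n. (norm (ell2_nth x n))\<^sup>2) summable_on UNIV"
  using square_summable_ell2_nth[of x] by (simp add: square_summable_def)

lemma norm_ell2_power2: "(norm x)\<^sup>2 = (\<Sum>\<^sub>\<infinity>n. (norm (ell2_nth x n))\<^sup>2)"
  unfolding norm_ell2_def by (simp add: infsum_nonneg)

lemma norm_ell2_nth_le: "norm (ell2_nth x n) \<le> norm x"
proof -
  have "(\<Sum>k\<in>{n}. (norm (ell2_nth x k))\<^sup>2) \<le> (norm x)\<^sup>2"
    unfolding norm_ell2_power2 by (rule finite_sum_le_infsum) (auto simp: summable_ell2)
  thus ?thesis by (simp add: power2_le_iff_abs_le)
qed

lemma norm_ell2_mono: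
  assumes "C \<ge> 0" "\<And>n. norm (ell2_nth x n) \<le> C * norm (ell2_nth y n)"
  shows "norm x \<le> C * norm y"
proof -
  have "(norm x)\<^sup>2 \<le> (\<Sum>\<^sub>\<infinity>n. C\<^sup>2 * (norm (ell2_nth y n))\<^sup>2)"
    unfolding norm_ell2_power2
  proof (rule infsum_mono)
    show "(\<lambda>n. C\<^sup>2 * (norm (ell2_nth y n))\<^sup>2) summable_on UNIV"
      by (intro summable_on_cmult_right summable_ell2)
    show "(norm (ell2_nth x n))\<^sup>2 \<le> C\<^sup>2 * (norm (ell2_nth y n))\<^sup>2" for n
      using power_mono[OF assms(2)[of n], of 2] by (simp add: power_mult_distrib)
  qed (rule summable_ell2)
  also have "\<dots> = (C * norm y)\<^sup>2"
    by (simp add: infsum_cmult_right' norm_ell2_power2 power_mult_distrib)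
  finally show ?thesis by (rule power2_le_imp_le) (use assms(1) in simp)
qed

lemma bounded_linear_ell2_nth: "bounded_linear (\<lambda>x. ell2_nth x n)"
  by (rule bounded_linear_intro[where K = 1]) (auto simp: norm_ell2_nth_le)

text \<open>
  The integrals and the fixed point theorem used below require completeness. A Cauchy sequence converges in every
  coordinate; the Cauchy estimates hold for all finite partial sums of squares, survive the passage to
  the coordinatewise limit there, and give both membership of the limit and convergence in norm.
\<close>

instance ell2 :: ("{real_inner, complete_space}") complete_space
proof
  fix X :: "nat \<Rightarrow> 'a ell2"
  assume X: "Cauchy X"
  have "Cauchy (\<lambda>k. ell2_nth (X k) n)" for n
    unfolding Cauchy_def
  proof (intro allI impI)
    fix e :: real assume "e > 0"
    then obtain M where M: "\<And>k m. k \<ge> M \<Longrightarrow> m \<ge> M \<Longrightarrow> norm (X k - X m) < e"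
      using X unfolding Cauchy_def dist_norm by meson
    have "dist (ell2_nth (X k) n) (ell2_nth (X m) n) < e" if "k \<ge> M" "m \<ge> M" for k m
      using norm_ell2_nth_le[of "X k - X m" n] M[OF that] by (simp add: dist_norm)
    thus "\<exists>M. \<forall>m\<ge>M. \<forall>k\<ge>M. dist (ell2_nth (X m) n) (ell2_nth (X k) n) < e" by blast
  qed
  hence "\<exists>l. (\<lambda>k. ell2_nth (X k) n) \<longlonglongrightarrow> l" for n
    using Cauchy_convergent convergent_def by blast
  then obtain l where l: "\<And>n. (\<lambda>k. ell2_nth (X k) n) \<longlonglongrightarrow> l n"
    by metis
  have partial: "(\<Sum>n\<in>F. (norm (ell2_nth (X k) n - l n))\<^sup>2) \<le> e\<^sup>2"
    if "e > 0" "\<And>m. m \<ge> M \<Longrightarrow> norm (X k - X m) < e" "finite F" for e M k F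
  proof (rule tendsto_upperbound)
    show "(\<lambda>m. \<Sum>n\<in>F. (norm (ell2_nth (X k) n - ell2_nth (X m) n))\<^sup>2)
        \<longlonglongrightarrow> (\<Sum>n\<in>F. (norm (ell2_nth (X k) n - l n))\<^sup>2)"
      by (intro tendsto_intros l)
    have "(\<Sum>n\<in>F. (norm (ell2_nth (X k) n - ell2_nth (X m) n))\<^sup>2) \<le> e\<^sup>2" if "m \<ge> M" for m
    proof -
      have "(\<Sum>n\<in>F. (norm (ell2_nth (X k - X m) n))\<^sup>2) \<le> (norm (X k - X m))\<^sup>2"
        unfolding norm_ell2_power2
        by (rule finite_sum_le_infsum) (auto simp: summable_ell2 \<open>finite F\<close> simp del: ell2_nth_simps)
      also have "\<dots> \<le> e\<^sup>2"
        using \<open>\<And>m. m \<ge> M \<Longrightarrow> norm (X k - X m) < e\<close>[OF that] by (intro power_mono) auto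
      finally show ?thesis by simp
    qed
    thus "\<forall>\<^sub>F m in sequentially. (\<Sum>n\<in>F. (norm (ell2_nth (X k) n - ell2_nth (X m) n))\<^sup>2) \<le> e\<^sup>2"
      unfolding eventually_sequentially by blast
  qed simp
  have diff: "square_summable (\<lambda>n. ell2_nth (X k) n - l n)"
    "norm (Abs_ell2 (\<lambda>n. ell2_nth (X k) n - l n)) \<le> e"
    if "e > 0" "\<And>m. m \<ge> M \<Longrightarrow> norm (X k - X m) < e" for e M k
  proof -
    have P: "(\<Sum>n\<in>F. (norm (ell2_nth (X k) n - l n))\<^sup>2) \<le> e\<^sup>2" if F: "finite F" for F
      by (rule partial[OF \<open>e > 0\<close> _ F]) (fact \<open>\<And>m. m \<ge> M \<Longrightarrow> norm (X k - X m) < e\<close>)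
    have "bdd_above (sum (\<lambda>n. (norm (ell2_nth (X k) n - l n))\<^sup>2) ` {F. F \<subseteq> UNIV \<and> finite F})"
      using P by (intro bdd_aboveI[of _ "e\<^sup>2"]) blast
    hence "(\<lambda>n. (norm (ell2_nth (X k) n - l n))\<^sup>2) summable_on UNIV"
      by (intro nonneg_bdd_above_summable_on) auto
    thus *: "square_summable (\<lambda>n. ell2_nth (X k) n - l n)" by (simp add: square_summable_def)
    have nth: "ell2_nth (Abs_ell2 (\<lambda>n. ell2_nth (X k) n - l n)) = (\<lambda>n. ell2_nth (X k) n - l n)"
      using * by (subst Abs_ell2_inverse) simp_all
    have "(norm (Abs_ell2 (\<lambda>n. ell2_nth (X k) n - l n)))\<^sup>2 \<le> e\<^sup>2"
      unfolding norm_ell2_power2 nth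
      by (rule infsum_le_finite_sums) (use * P in \<open>auto simp: square_summable_def\<close>)
    thus "norm (Abs_ell2 (\<lambda>n. ell2_nth (X k) n - l n)) \<le> e"
      by (rule power2_le_imp_le) (use \<open>e > 0\<close> in simp)
  qed
  have ex: "\<exists>M. \<forall>k\<ge>M. \<forall>m\<ge>M. norm (X k - X m) < e" if "e > 0" for e
    using X that unfolding Cauchy_def dist_norm by meson
  obtain M1 where M1: "\<And>m. m \<ge> M1 \<Longrightarrow> norm (X M1 - X m) < 1"
    using ex[of 1] by auto
  have "square_summable (\<lambda>n. ell2_nth (X M1) n - (ell2_nth (X M1) n - l n))"
    by (intro square_summable_diff square_summable_ell2_nth diff(1)[OF _ M1]) auto
  hence sl: "square_summable l" by simp
  define L where "L = Abs_ell2 l"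
  have L: "ell2_nth L n = l n" for n using sl by (simp add: L_def Abs_ell2_inverse)
  have "X \<longlonglongrightarrow> L"
  proof (rule LIMSEQ_I)
    fix e :: real assume e: "e > 0"
    obtain M where M: "\<And>k m. k \<ge> M \<Longrightarrow> m \<ge> M \<Longrightarrow> norm (X k - X m) < e / 2"
      using ex[of "e / 2"] e by auto
    have "norm (X k - L) < e" if "k \<ge> M" for k
    proof -
      have "X k - L = Abs_ell2 (\<lambda>n. ell2_nth (X k) n - l n)"
        using diff(1)[of "e / 2" M k] M[OF that] e
        by (intro ell2_eqI) (simp add: Abs_ell2_inverse L)
      thus ?thesis using diff(2)[of "e / 2" M k] M[OF that] e by simp
    qed
    thus "\<exists>M. \<forall>k\<ge>M. norm (X k - L) < e" by blast
  qed
  thus "convergent X" by (auto simp: convergent_def)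
qed

instance ell2 :: ("{real_inner, banach}") banach ..

text \<open>
  Summation by parts: the two difference operators are negative adjoints of each other. This is the
  source of the norm conservation of the amplitude equation.
\<close>

lemma inner_delta_plus:
  fixes x y :: "'a::real_inner ell2"
  shows "inner x (delta_plus y) = - inner (delta_minus x) y"
proof -
  note S = square_summable_inner[OF square_summable_ell2_nth square_summable_ell2_nth]
  have bij: "bij_betw (\<lambda>n. n - 1) UNIV (UNIV :: int set)"
    by (rule bij_betwI[where g = "\<lambda>n. n + 1"]) auto
  have Sx: "(\<lambda>n. ell2_nth x (n - 1) \<bullet> ell2_nth y n) summable_on UNIV"
    using square_summable_inner[OF square_summable_shift[OF square_summable_ell2_nth[of x], of "-1"]
        square_summable_ell2_nth[of y]] by simp
  have Sy: "(\<lambda>n. ell2_nth x n \<bullet> ell2_nth y (n + 1)) summable_on UNIV"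
    by (rule square_summable_inner[OF square_summable_ell2_nth[of x]
        square_summable_shift[OF square_summable_ell2_nth[of y], of 1]])
  have shift: "(\<Sum>\<^sub>\<infinity>n. ell2_nth x n \<bullet> ell2_nth y (n + 1)) = (\<Sum>\<^sub>\<infinity>n. ell2_nth x (n - 1) \<bullet> ell2_nth y n)"
    using infsum_reindex_bij_betw[OF bij, of "\<lambda>n. ell2_nth x n \<bullet> ell2_nth y (n + 1)"] by simp
  have 1: "(\<Sum>\<^sub>\<infinity>n. ell2_nth x n \<bullet> ell2_nth y (n + 1)) = inner x (delta_plus y) + inner x y"
    unfolding inner_ell2_def by (subst infsum_add[OF S S, symmetric]) (simp add: inner_diff_right)
  have 2: "inner x y = inner (delta_minus x) y + (\<Sum>\<^sub>\<infinity>n. ell2_nth x (n - 1) \<bullet> ell2_nth y n)"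
    unfolding inner_ell2_def by (subst infsum_add[OF S Sx, symmetric]) (simp add: inner_diff_left)
  show ?thesis using 1 2 shift by simp
qed

lemma norm_shift_ell2:
  "(\<Sum>\<^sub>\<infinity>n. (norm (ell2_nth x (n + k)))\<^sup>2) = (norm x)\<^sup>2"
proof -
  have bij: "bij_betw (\<lambda>n. n + k) UNIV (UNIV :: int set)"
    by (rule bij_betwI[where g = "\<lambda>n. n - k"]) auto
  show ?thesis
    using infsum_reindex_bij_betw[OF bij, of "\<lambda>n. (norm (ell2_nth x n))\<^sup>2"]
    by (simp add: norm_ell2_power2)
qed

lemma norm_delta_plus_le: "norm (delta_plus x) \<le> 2 * norm x"
proof -
  define s where "s = Abs_ell2 (\<lambda>n. ell2_nth x (n + 1))"
  have s: "ell2_nth s n = ell2_nth x (n + 1)" for n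
    by (simp add: s_def Abs_ell2_inverse square_summable_shift[OF square_summable_ell2_nth])
  have "(norm s)\<^sup>2 = (norm x)\<^sup>2"
    using norm_shift_ell2[of x 1] by (simp add: norm_ell2_power2 s)
  moreover have "delta_plus x = s - x" by (intro ell2_eqI) (simp add: s)
  ultimately show ?thesis using norm_triangle_ineq4[of s x] by simp
qed

lemma norm_delta_minus_le: "norm (delta_minus x) \<le> 2 * norm x"
proof -
  define s where "s = Abs_ell2 (\<lambda>n. ell2_nth x (n - 1))"
  have s: "ell2_nth s n = ell2_nth x (n - 1)" for n
    using square_summable_shift[OF square_summable_ell2_nth[of x], of "-1"]
    by (simp add: s_def Abs_ell2_inverse)
  have "(norm s)\<^sup>2 = (norm x)\<^sup>2"
    using norm_shift_ell2[of x "-1"] by (simp add: norm_ell2_power2 s)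
  moreover have "delta_minus x = x - s" by (intro ell2_eqI) (simp add: s)
  ultimately show ?thesis using norm_triangle_ineq4[of x s] by simp
qed

section \<open>Differential equations with a Lipschitz right-hand side\<close>

lemma continuous_on_norm_lipschitz:
  fixes f :: "'a::real_normed_vector \<Rightarrow> 'b::real_normed_vector"
  assumes "L \<ge> 0" "\<And>x y. x \<in> S \<Longrightarrow> y \<in> S \<Longrightarrow> norm (f x - f y) \<le> L * norm (x - y)"
  shows "continuous_on S f"
  using assms by (intro lipschitz_on_continuous_on[of L] lipschitz_onI) (auto simp: dist_norm)

text \<open>
  The radial retraction onto the closed ball of radius \<open>r\<close>. Composing a locally Lipschitz vector field
  with it yields a globally Lipschitz one.
\<close>

definition cap_norm :: "real \<Rightarrow> 'a::real_normed_vector \<Rightarrow> 'a" where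
  "cap_norm r x = (if norm x \<le> r then x else (r / norm x) *\<^sub>R x)"

lemma norm_cap_norm: "r \<ge> 0 \<Longrightarrow> norm (cap_norm r x) \<le> r"
  by (simp add: cap_norm_def)

lemma cap_norm_id: "norm x \<le> r \<Longrightarrow> cap_norm r x = x"
  by (simp add: cap_norm_def)

text \<open>
  In a general normed space the radial retraction need not be a contraction; the factor two comes from
  moving a point radially by at most \<open>\<bar>norm x - norm y\<bar>\<close> in addition to \<open>norm (x - y)\<close>.
\<close>

lemma cap_norm_lipschitz:
  assumes "r \<ge> 0"
  shows "norm (cap_norm r x - cap_norm r y) \<le> 2 * norm (x - y)"
proof -
  have mixed: "norm (x - (r / norm y) *\<^sub>R y) \<le> 2 * norm (x - y)"
    if "norm x \<le> r" "r < norm y" for x y :: 'a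
  proof -
    have "norm (y - (r / norm y) *\<^sub>R y) = norm ((1 - r / norm y) *\<^sub>R y)"
      by (simp add: scaleR_left_diff_distrib)
    also have "\<dots> = \<bar>1 - r / norm y\<bar> * norm y"
      by (rule norm_scaleR)
    also have "\<dots> = norm y - r"
    proof -
      have "norm y > 0" using that assms by linarith
      thus ?thesis using that by (simp add: abs_if field_simps)
    qed
    also have "\<dots> \<le> norm (x - y)"
      using that norm_triangle_ineq2[of y x] by (simp add: norm_minus_commute)
    finally show ?thesis
      using norm_triangle_ineq[of "x - y" "y - (r / norm y) *\<^sub>R y"] by simp
  qed
  have outer: "norm ((r / norm x) *\<^sub>R x - (r / norm y) *\<^sub>R y) \<le> 2 * norm (x - y)"
    if "r < norm x" "r < norm y" for x y :: 'a
  proof -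
    have pos: "norm x > 0" "norm y > 0" using that assms by linarith+
    have "norm ((r / norm x - r / norm y) *\<^sub>R y) = \<bar>(r / norm x - r / norm y) * norm y\<bar>"
      by (simp add: abs_mult)
    also have "(r / norm x - r / norm y) * norm y = (r / norm x) * (norm y - norm x)"
      using pos by (simp add: field_simps)
    also have "\<bar>\<dots>\<bar> \<le> 1 * norm (x - y)"
      unfolding abs_mult using pos that assms norm_triangle_ineq3[of y x]
      by (intro mult_mono) (auto simp: norm_minus_commute)
    finally have 1: "norm ((r / norm x - r / norm y) *\<^sub>R y) \<le> norm (x - y)" by simp
    have 2: "norm ((r / norm x) *\<^sub>R (x - y)) \<le> 1 * norm (x - y)"
      unfolding norm_scaleR using that pos assms by (intro mult_right_mono) auto
    have "(r / norm x) *\<^sub>R x - (r / norm y) *\<^sub>R y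
        = (r / norm x) *\<^sub>R (x - y) + (r / norm x - r / norm y) *\<^sub>R y"
      by (simp add: algebra_simps)
    thus ?thesis
      using norm_triangle_ineq[of "(r / norm x) *\<^sub>R (x - y)" "(r / norm x - r / norm y) *\<^sub>R y"] 1 2
      by simp
  qed
  show ?thesis
    using mixed[of x y] mixed[of y x] outer[of x y] norm_ge_zero[of "x - y"]
    by (simp add: cap_norm_def norm_minus_commute)
qed

text \<open>
  The function \<open>t \<mapsto> (c + K * \<integral> u) * exp (- K * t)\<close> has a nonpositive derivative by the hypothesis.
\<close>

lemma gronwall_integral:
  fixes u :: "real \<Rightarrow> real"
  assumes cont: "continuous_on {0..T} u" and K: "K \<ge> 0"
    and le: "\<And>t. t \<in> {0..T} \<Longrightarrow> u t \<le> c + K * integral {0..t} u"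
    and t: "t \<in> {0..T}"
  shows "u t \<le> c * exp (K * t)"
proof -
  define U where "U = (\<lambda>t. (c + K * integral {0..t} u) * exp (- K * t))"
  have der: "(U has_real_derivative (K * u s - K * (c + K * integral {0..s} u)) * exp (- K * s))
      (at s within {0..T})" if "s \<in> {0..T}" for s
  proof -
    have "((\<lambda>t. integral {0..t} u) has_real_derivative u s) (at s within {0..T})"
      using integral_has_vector_derivative[OF cont that]
      by (simp add: has_real_derivative_iff_has_vector_derivative)
    thus ?thesis
      unfolding U_def by (auto intro!: derivative_eq_intros simp: algebra_simps)
  qed
  have "U t \<le> U 0"
  proof (rule DERIV_nonpos_imp_decreasing_open[where f = U])
    show "0 \<le> t" using t by simp
    show "\<exists>y. (U has_real_derivative y) (at x) \<and> y \<le> 0" if "0 < x" "x < t" for x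
    proof -
      have "(U has_real_derivative (K * u x - K * (c + K * integral {0..x} u)) * exp (- K * x)) (at x)"
        using der[of x] that t by (simp add: at_within_Icc_at)
      moreover have "(K * u x - K * (c + K * integral {0..x} u)) * exp (- K * x) \<le> 0"
        using mult_left_mono[OF le[of x] K] that t
        by (intro mult_nonpos_nonneg) auto
      ultimately show ?thesis by blast
    qed
    show "continuous_on {0..t} U"
      using continuous_on_subset[OF DERIV_continuous_on[OF der]] t by auto
  qed
  hence "(c + K * integral {0..t} u) * exp (- K * t) \<le> c" by (simp add: U_def)
  hence "c + K * integral {0..t} u \<le> c * exp (K * t)"
    by (simp add: exp_minus divide_simps flip: minus_mult_left)
  with le[OF t] show ?thesis by linarith
qed

text \<open>
  Existence by Banach's fixed point theorem on the whole interval at once. The unknown is rescaled to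
  \<open>exp (- 2 * K * t) *\<^sub>R u t\<close>, in which the integral operator contracts by one half whatever the length of
  the interval, since \<open>K * \<integral> exp (2 * K * s) \<le> exp (2 * K * t) / 2\<close>.
\<close>

lemma global_lipschitz_ivp:
  fixes f :: "real \<Rightarrow> 'a::banach \<Rightarrow> 'a"
  assumes T: "T \<ge> 0"
    and cont: "\<And>u. continuous_on {0..T} u \<Longrightarrow> continuous_on {0..T} (\<lambda>t. f t (u t))"
    and lip: "\<And>t x y. t \<in> {0..T} \<Longrightarrow> norm (f t x - f t y) \<le> L * norm (x - y)"
  obtains u where "u 0 = x0"
    "\<And>t. t \<in> {0..T} \<Longrightarrow> (u has_vector_derivative f t (u t)) (at t within {0..T})"
proof -
  define K where "K = max L 1"
  have K: "K > 0" by (simp add: K_def)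
  have lip: "norm (f t x - f t y) \<le> K * norm (x - y)" if "t \<in> {0..T}" for t x y
    using lip[OF that, of x y] mult_right_mono[of L K "norm (x - y)"] by (simp add: K_def)
  \<comment> \<open>Bounded continuous functions live on the whole line, so time is clamped to the interval.\<close>
  define c where "c = (\<lambda>t. max 0 (min T t))"
  have c: "c t \<in> {0..T}" for t using T by (auto simp: c_def)
  have c_id: "t \<in> {0..T} \<Longrightarrow> c t = t" for t by (auto simp: c_def)
  have cont_c: "continuous_on A c" for A unfolding c_def by (intro continuous_intros)
  define un where "un = (\<lambda>v :: real \<Rightarrow>\<^sub>C 'a. \<lambda>t. exp (2 * K * t) *\<^sub>R v t)"
  have cont_un: "continuous_on A (un v)" for A v
    unfolding un_def by (intro continuous_intros) auto
  have cont_f: "continuous_on {0..T} (\<lambda>s. f s (un v s))" for v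
    by (rule cont[OF cont_un])
  define H where "H = (\<lambda>v t. x0 + integral {0..t} (\<lambda>s. f s (un v s)))"
  have derH: "(H v has_vector_derivative f t (un v t)) (at t within {0..T})" if "t \<in> {0..T}" for v t
    unfolding H_def using integral_has_vector_derivative[OF cont_f that]
    by (auto intro!: derivative_eq_intros)
  have contH: "continuous_on {0..T} (H v)" for v
    using derH by (rule continuous_on_vector_derivative)
  define g where "g = (\<lambda>v t. exp (- 2 * K * c t) *\<^sub>R H v (c t))"
  have contg: "continuous_on UNIV (g v)" for v
    unfolding g_def using c
    by (intro continuous_intros cont_c continuous_on_compose2[OF contH]) auto
  have "bounded (range (g v))" for v
  proof -
    have "bounded (g v ` {0..T})"
      by (intro compact_imp_bounded compact_continuous_image continuous_on_subset[OF contg]) auto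
    moreover have "g v t = g v (c t)" for t unfolding g_def by (simp add: c_id[OF c])
    hence "range (g v) \<subseteq> g v ` {0..T}" using c by blast
    ultimately show ?thesis using bounded_subset by blast
  qed
  hence gB: "apply_bcontfun (Bcontfun (g v)) = g v" for v
    using contg by (intro Bcontfun_inverse) (auto simp: bcontfun_def)
  have contr: "dist (Bcontfun (g v)) (Bcontfun (g w)) \<le> 1/2 * dist v w" for v w
  proof (rule dist_bound)
    fix t
    define s where "s = c t"
    have s: "s \<in> {0..T}" using c by (simp add: s_def)
    have sub: "{0..s} \<subseteq> {0..T}" using s by auto
    have int: "(\<lambda>r. f r (un v r)) integrable_on {0..s}" for v
      by (intro integrable_continuous_real continuous_on_subset[OF cont_f sub])
    have I: "((\<lambda>r. K * exp (2 * K * r) * dist v w) has_integral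
        (exp (2 * K * s) / 2 * dist v w - exp (2 * K * 0) / 2 * dist v w)) {0..s}"
      using s K by (intro fundamental_theorem_of_calculus)
        (auto intro!: derivative_eq_intros simp flip: has_real_derivative_iff_has_vector_derivative)
    have "norm (H v s - H w s) = norm (integral {0..s} (\<lambda>r. f r (un v r) - f r (un w r)))"
      by (simp add: H_def Henstock_Kurzweil_Integration.integral_diff int)
    also have "\<dots> \<le> integral {0..s} (\<lambda>r. K * exp (2 * K * r) * dist v w)"
    proof (rule integral_norm_bound_integral)
      show "(\<lambda>r. f r (un v r) - f r (un w r)) integrable_on {0..s}" by (intro integrable_diff int)
      show "(\<lambda>r. K * exp (2 * K * r) * dist v w) integrable_on {0..s}" using I by blast
      fix r assume r: "r \<in> {0..s}"
      have "norm (un v r - un w r) = exp (2 * K * r) * dist (v r) (w r)"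
        by (simp add: un_def dist_norm flip: scaleR_diff_right)
      also have "\<dots> \<le> exp (2 * K * r) * dist v w" by (simp add: dist_bounded)
      finally have "K * norm (un v r - un w r) \<le> K * exp (2 * K * r) * dist v w" using K by simp
      thus "norm (f r (un v r) - f r (un w r)) \<le> K * exp (2 * K * r) * dist v w"
        using lip[of r "un v r" "un w r"] r sub by force
    qed
    also have "\<dots> \<le> exp (2 * K * s) / 2 * dist v w"
      using integral_unique[OF I] by simp
    finally have "exp (- (2 * K * s)) * norm (H v s - H w s) \<le> exp (- (2 * K * s)) * (exp (2 * K * s) / 2 * dist v w)"
      by simp
    also have "\<dots> = 1/2 * dist v w" by (simp add: exp_minus)
    finally show "dist (Bcontfun (g v) t) (Bcontfun (g w) t) \<le> 1/2 * dist v w"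
      unfolding gB by (simp add: g_def dist_norm flip: scaleR_diff_right s_def)
  qed
  have "\<exists>!v. Bcontfun (g v) = v"
    by (rule banach_fix_type[of "1/2"]) (use contr in auto)
  then obtain v where "Bcontfun (g v) = v" by blast
  hence v: "apply_bcontfun v = g v" using gB[of v] by simp
  have unH: "un v t = H v t" if "t \<in> {0..T}" for t
    by (simp add: un_def v g_def c_id[OF that] flip: exp_add)
  show ?thesis
  proof (rule that[of "H v"])
    show "H v 0 = x0" by (simp add: H_def)
    show "(H v has_vector_derivative f t (H v t)) (at t within {0..T})" if "t \<in> {0..T}" for t
      using derH[OF that, of v] unH[OF that] by simp
  qed
qed

section \<open>Averaging\<close>

text \<open>
  The mean-zero field \<open>N\<close> is evaluated along a slowly moving curve \<open>P\<close>. On each full period, \<open>P\<close> may be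
  frozen at its initial value at the cost \<open>K * (M * p)\<close> per unit of time, and the frozen integral
  vanishes. The remaining piece, shorter than a period, costs at most \<open>p * B\<close>. Freezing takes only the
  Lipschitz continuity of \<open>N\<close>.
\<close>

lemma averaged_integral_bound:
  fixes N :: "real \<Rightarrow> 'a::banach \<Rightarrow> 'a" and P :: "real \<Rightarrow> 'a"
  assumes p: "p > 0" and nonneg: "B \<ge> 0" "K \<ge> 0" "M \<ge> 0"
    and cont: "\<And>u. continuous_on {0..T} u \<Longrightarrow> (\<And>t. t \<in> {0..T} \<Longrightarrow> norm (u t) \<le> r) \<Longrightarrow>
      continuous_on {0..T} (\<lambda>t. N t (u t))"
    and mean: "\<And>s x. norm x \<le> r \<Longrightarrow> integral {s..s + p} (\<lambda>t. N t x) = 0"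
    and bound: "\<And>t x. norm x \<le> r \<Longrightarrow> norm (N t x) \<le> B"
    and lip: "\<And>t x y. norm x \<le> r \<Longrightarrow> norm y \<le> r \<Longrightarrow> norm (N t x - N t y) \<le> K * norm (x - y)"
    and P: "\<And>t. t \<in> {0..T} \<Longrightarrow> norm (P t) \<le> r"
    and slow: "\<And>s t. s \<in> {0..T} \<Longrightarrow> t \<in> {0..T} \<Longrightarrow> norm (P s - P t) \<le> M * \<bar>s - t\<bar>"
    and t: "t \<in> {0..T}"
  shows "norm (integral {0..t} (\<lambda>s. N s (P s))) \<le> p * B + t * (K * M * p)"
proof -
  have contP: "continuous_on {0..T} P"
    using slow nonneg by (intro lipschitz_on_continuous_on[of M] lipschitz_onI) (auto simp: dist_norm)
  have intP: "(\<lambda>s. N s (P s)) integrable_on {a..b}" if "0 \<le> a" "b \<le> T" for a b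
    using that by (intro integrable_continuous_real continuous_on_subset[OF cont[OF contP P]]) auto
  have intx: "(\<lambda>s. N s x) integrable_on {a..b}" if "0 \<le> a" "b \<le> T" "norm x \<le> r" for a b x
    using that by (intro integrable_continuous_real continuous_on_subset[OF cont]) auto
  \<comment> \<open>The induction removes the last period, so the incomplete one is at the start.\<close>
  have "norm (integral {0..t} (\<lambda>s. N s (P s))) \<le> p * B + t * (K * M * p)"
    if "t \<in> {0..T}" "t \<le> real n * p" for t n
    using that
  proof (induction n arbitrary: t)
    case 0
    thus ?case using p nonneg by simp
  next
    case (Suc n)
    show ?case
    proof (cases "t \<le> p")
      case True
      have "norm (integral {0..t} (\<lambda>s. N s (P s))) \<le> B * (t - 0)"
        using Suc.prems P
        by (intro integral_bound continuous_on_subset[OF cont[OF contP P]] bound) auto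
      also have "\<dots> \<le> p * B" using True nonneg by (simp add: mult.commute mult_left_mono)
      finally show ?thesis using Suc.prems p nonneg by (simp add: add_increasing2)
    next
      case False
      define a where "a = t - p"
      have a: "0 \<le> a" "a \<le> t" "t \<le> T" "t = a + p" using False Suc.prems p by (auto simp: a_def)
      have IH: "norm (integral {0..a} (\<lambda>s. N s (P s))) \<le> p * B + a * (K * M * p)"
        using Suc.prems a by (intro Suc.IH) (auto simp: algebra_simps)
      have "integral {a..t} (\<lambda>s. N s (P s)) = integral {a..t} (\<lambda>s. N s (P s) - N s (P a))"
        using mean[of "P a" a] P[of a] a
        by (subst Henstock_Kurzweil_Integration.integral_diff[OF intP intx]) auto
      also have "norm \<dots> \<le> (K * M * p) * (t - a)"
      proof (rule integral_bound)
        show "continuous_on {a..t} (\<lambda>s. N s (P s) - N s (P a))"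
          using a by (intro continuous_on_diff continuous_on_subset[OF cont[OF contP P]]
              continuous_on_subset[OF cont[OF continuous_on_const P]]) auto
        fix s assume s: "s \<in> {a..t}"
        have "norm (N s (P s) - N s (P a)) \<le> K * norm (P s - P a)"
          using s a by (intro lip P) auto
        also have "\<dots> \<le> K * (M * p)"
        proof (rule mult_left_mono)
          have "norm (P s - P a) \<le> M * \<bar>s - a\<bar>" using s a by (intro slow) auto
          also have "\<dots> \<le> M * p" using s a nonneg by (intro mult_left_mono) auto
          finally show "norm (P s - P a) \<le> M * p" .
        qed (rule nonneg)
        finally show "norm (N s (P s) - N s (P a)) \<le> K * M * p" by (simp add: mult.assoc)
      qed (use a in auto)
      finally have "norm (integral {a..t} (\<lambda>s. N s (P s))) \<le> p * (K * M * p)"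
        using a by (simp add: mult.commute)
      moreover have "integral {0..t} (\<lambda>s. N s (P s))
          = integral {0..a} (\<lambda>s. N s (P s)) + integral {a..t} (\<lambda>s. N s (P s))"
        using a by (intro Henstock_Kurzweil_Integration.integral_combine[symmetric] intP) auto
      ultimately have "norm (integral {0..t} (\<lambda>s. N s (P s)))
          \<le> p * B + a * (K * M * p) + p * (K * M * p)"
        using IH norm_triangle_ineq[of "integral {0..a} (\<lambda>s. N s (P s))" "integral {a..t} (\<lambda>s. N s (P s))"]
        by simp
      thus ?thesis using a(4) by (simp add: distrib_right)
    qed
  qed
  moreover obtain n where "t \<le> real n * p"
    using reals_Archimedean3[OF p] less_imp_le by blast
  ultimately show ?thesis using t by blast
qed

text \<open>
  A curve \<open>P\<close> that solves the equation up to a defect \<open>R\<close> stays close to a true solution as soon as the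
  \<^emph>\<open>integral\<close> of the defect is small; the defect itself may be large and oscillating.
\<close>

lemma perturbed_flow_estimate:
  fixes F :: "real \<Rightarrow> 'a::banach \<Rightarrow> 'a"
  assumes K: "K \<ge> 0"
    and cont: "\<And>u. continuous_on {0..T} u \<Longrightarrow> continuous_on {0..T} (\<lambda>t. F t (u t))"
    and lip: "\<And>t x y. norm (F t x - F t y) \<le> K * norm (x - y)"
    and Y: "\<And>t. t \<in> {0..T} \<Longrightarrow> (Y has_vector_derivative F t (Y t)) (at t within {0..T})"
    and P: "\<And>t. t \<in> {0..T} \<Longrightarrow> (P has_vector_derivative F t (P t) - R t) (at t within {0..T})"
    and contR: "continuous_on {0..T} R"
    and small: "\<And>t. t \<in> {0..T} \<Longrightarrow> norm (integral {0..t} R) \<le> E"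
    and t: "t \<in> {0..T}"
  shows "norm (Y t - P t) \<le> (norm (Y 0 - P 0) + E) * exp (K * t)"
proof (rule gronwall_integral[where u = "\<lambda>t. norm (Y t - P t)", OF _ K _ t])
  have contY: "continuous_on {0..T} Y" and contP: "continuous_on {0..T} P"
    using continuous_on_vector_derivative[OF Y] continuous_on_vector_derivative[OF P] by auto
  thus "continuous_on {0..T} (\<lambda>t. norm (Y t - P t))" by (intro continuous_intros)
  fix t assume t: "t \<in> {0..T}"
  have sub: "{0..t} \<subseteq> {0..T}" using t by auto
  have intR: "R integrable_on {0..t}"
    by (intro integrable_continuous_real continuous_on_subset[OF contR sub])
  have intF: "(\<lambda>s. F s (Y s) - F s (P s)) integrable_on {0..t}"
    by (intro integrable_continuous_real continuous_on_diff
        continuous_on_subset[OF cont[OF contY] sub] continuous_on_subset[OF cont[OF contP] sub])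
  have intn: "(\<lambda>s. K * norm (Y s - P s)) integrable_on {0..t}"
    by (intro integrable_continuous_real continuous_intros
        continuous_on_subset[OF contY sub] continuous_on_subset[OF contP sub])
  have "((\<lambda>s. F s (Y s) - (F s (P s) - R s)) has_integral (Y t - P t) - (Y 0 - P 0)) {0..t}"
    using t
    by (intro fundamental_theorem_of_calculus has_vector_derivative_diff
        has_vector_derivative_within_subset[OF Y] has_vector_derivative_within_subset[OF P]) auto
  hence "(Y t - P t) - (Y 0 - P 0) = integral {0..t} (\<lambda>s. (F s (Y s) - F s (P s)) + R s)"
    by (simp add: integral_unique algebra_simps)
  also have "\<dots> = integral {0..t} (\<lambda>s. F s (Y s) - F s (P s)) + integral {0..t} R"
    by (rule Henstock_Kurzweil_Integration.integral_add[OF intF intR])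
  finally have "Y t - P t = ((Y 0 - P 0) + integral {0..t} R) + integral {0..t} (\<lambda>s. F s (Y s) - F s (P s))"
    by (simp add: algebra_simps)
  hence "norm (Y t - P t) \<le> norm ((Y 0 - P 0) + integral {0..t} R)
      + norm (integral {0..t} (\<lambda>s. F s (Y s) - F s (P s)))"
    by (simp only: norm_triangle_ineq)
  moreover have "norm ((Y 0 - P 0) + integral {0..t} R) \<le> norm (Y 0 - P 0) + norm (integral {0..t} R)"
    by (rule norm_triangle_ineq)
  moreover have "norm (integral {0..t} (\<lambda>s. F s (Y s) - F s (P s)))
      \<le> integral {0..t} (\<lambda>s. K * norm (Y s - P s))"
    by (rule integral_norm_bound_integral[OF intF intn]) (rule lip)
  moreover have "integral {0..t} (\<lambda>s. K * norm (Y s - P s)) = K * integral {0..t} (\<lambda>s. norm (Y s - P s))"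
    by (rule integral_mult_right)
  ultimately show "norm (Y t - P t) \<le> norm (Y 0 - P 0) + E + K * integral {0..t} (\<lambda>t. norm (Y t - P t))"
    using small[OF t] by linarith
qed

section \<open>The homogeneous force and its means over a period\<close>

text \<open>
  The power of the positive part. Both branches of the homogeneous potential, and its first two
  derivatives, are combinations of \<open>pos_powr a r\<close> and \<open>pos_powr a (- r)\<close>, which removes case
  distinctions at the origin.
\<close>

definition pos_powr :: "real \<Rightarrow> real \<Rightarrow> real" where
  "pos_powr a r = max r 0 powr a"

lemma pos_powr_nonneg [simp]: "pos_powr a r \<ge> 0"
  by (simp add: pos_powr_def)

lemma pos_powr_le: "a > 0 \<Longrightarrow> pos_powr a r \<le> \<bar>r\<bar> powr a"
  by (auto simp: pos_powr_def max_def)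

lemma pos_powr_mult: "\<rho> \<ge> 0 \<Longrightarrow> pos_powr a (\<rho> * r) = \<rho> powr a * pos_powr a r"
  by (cases "\<rho> = 0") (auto simp: pos_powr_def max_def powr_mult zero_le_mult_iff mult_le_0_iff)

lemma pos_powr_times_self: "a > 0 \<Longrightarrow> pos_powr a r * r = pos_powr (a + 1) r"
  by (auto simp: pos_powr_def max_def powr_add)

lemma continuous_on_pos_powr [continuous_intros]:
  fixes f :: "'a::topological_space \<Rightarrow> real"
  assumes "a > 0" "continuous_on S f"
  shows "continuous_on S (\<lambda>x. pos_powr a (f x))"
  unfolding pos_powr_def using assms by (intro continuous_on_powr' continuous_intros) auto

lemma has_real_derivative_pos_powr:
  assumes "a > 1"
  shows "(pos_powr a has_real_derivative a * pos_powr (a - 1) r) (at r)"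
proof -
  consider "r < 0" | "r > 0" | "r = 0" by linarith
  thus ?thesis
  proof cases
    case 1
    have "((\<lambda>_. 0) has_real_derivative 0) (at r)" by simp
    hence "(pos_powr a has_real_derivative 0) (at r)"
      by (rule has_field_derivative_transform_within_open[where S = "{..<0}"])
        (use 1 in \<open>auto simp: pos_powr_def\<close>)
    thus ?thesis using 1 by (simp add: pos_powr_def)
  next
    case 2
    have "((\<lambda>r. r powr a) has_real_derivative a * r powr (a - 1)) (at r)"
      using 2 by (auto intro!: derivative_eq_intros)
    hence "(pos_powr a has_real_derivative a * r powr (a - 1)) (at r)"
      by (rule has_field_derivative_transform_within_open[where S = "{0<..}"])
        (use 2 in \<open>auto simp: pos_powr_def\<close>)
    thus ?thesis using 2 by (simp add: pos_powr_def)
  next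
    case 3
    have "((\<lambda>r::real. \<bar>r\<bar> powr (a - 1)) \<longlongrightarrow> \<bar>0\<bar> powr (a - 1)) (at 0)"
      using assms by (intro tendsto_intros) auto
    hence lim: "((\<lambda>r::real. \<bar>r\<bar> powr (a - 1)) \<longlongrightarrow> 0) (at 0)" using assms by simp
    have "norm (pos_powr a r / r) \<le> \<bar>r\<bar> powr (a - 1)" for r
    proof (cases "r > 0")
      case True
      thus ?thesis by (simp add: pos_powr_def powr_diff)
    qed (simp add: pos_powr_def)
    hence "((\<lambda>r. pos_powr a r / r) \<longlongrightarrow> 0) (at 0)"
      by (intro Lim_null_comparison[OF _ lim] always_eventually) blast
    thus ?thesis using 3 by (simp add: has_field_derivative_iff pos_powr_def)
  qed
qed

definition force_hom :: "real \<Rightarrow> real \<Rightarrow> real \<Rightarrow> real \<Rightarrow> real" where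
  "force_hom \<alpha> km kp r = kp * pos_powr \<alpha> r - km * pos_powr \<alpha> (- r)"

definition stiffness_hom :: "real \<Rightarrow> real \<Rightarrow> real \<Rightarrow> real \<Rightarrow> real" where
  "stiffness_hom \<alpha> km kp r = kp * \<alpha> * pos_powr (\<alpha> - 1) r + km * \<alpha> * pos_powr (\<alpha> - 1) (- r)"

lemma V_hom_eq_pos_powr:
  assumes "\<alpha> > 1"
  shows "V_hom \<alpha> km kp r = kp / (1 + \<alpha>) * pos_powr (\<alpha> + 1) r + km / (1 + \<alpha>) * pos_powr (\<alpha> + 1) (- r)"
  using assms by (auto simp: V_hom_def pos_powr_def max_def)

lemma has_derivative_V_hom:
  assumes "\<alpha> > 1"
  shows "(V_hom \<alpha> km kp has_real_derivative force_hom \<alpha> km kp r) (at r)"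
proof -
  have "((\<lambda>r. kp / (1 + \<alpha>) * pos_powr (\<alpha> + 1) r + km / (1 + \<alpha>) * pos_powr (\<alpha> + 1) (- r))
      has_real_derivative kp / (1 + \<alpha>) * ((\<alpha> + 1) * pos_powr (\<alpha> + 1 - 1) r)
        + km / (1 + \<alpha>) * ((\<alpha> + 1) * pos_powr (\<alpha> + 1 - 1) (- r) * (-1))) (at r)"
    using assms
    by (intro DERIV_add DERIV_cmult has_real_derivative_pos_powr
        DERIV_chain2[OF has_real_derivative_pos_powr]) (auto intro!: derivative_eq_intros)
  also have "(\<lambda>r. kp / (1 + \<alpha>) * pos_powr (\<alpha> + 1) r + km / (1 + \<alpha>) * pos_powr (\<alpha> + 1) (- r))
      = V_hom \<alpha> km kp"
    using V_hom_eq_pos_powr[OF assms] by auto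
  finally show ?thesis using assms by (simp add: force_hom_def add.commute)
qed

lemma has_derivative_force_hom:
  assumes "\<alpha> > 1"
  shows "(force_hom \<alpha> km kp has_real_derivative stiffness_hom \<alpha> km kp r) (at r)"
proof -
  have "((\<lambda>r. kp * pos_powr \<alpha> r - km * pos_powr \<alpha> (- r)) has_real_derivative
      kp * (\<alpha> * pos_powr (\<alpha> - 1) r) - km * (\<alpha> * pos_powr (\<alpha> - 1) (- r) * (-1))) (at r)"
    using assms
    by (intro DERIV_diff DERIV_cmult has_real_derivative_pos_powr
        DERIV_chain2[OF has_real_derivative_pos_powr]) (auto intro!: derivative_eq_intros)
  thus ?thesis by (simp add: force_hom_def[abs_def] stiffness_hom_def mult.assoc)
qed

lemma deriv_V_hom: "\<alpha> > 1 \<Longrightarrow> deriv (V_hom \<alpha> km kp) = force_hom \<alpha> km kp"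
  by (intro ext DERIV_imp_deriv has_derivative_V_hom)

lemma deriv_force_hom: "\<alpha> > 1 \<Longrightarrow> deriv (force_hom \<alpha> km kp) = stiffness_hom \<alpha> km kp"
  by (intro ext DERIV_imp_deriv has_derivative_force_hom)

lemma continuous_stiffness_hom: "\<alpha> > 1 \<Longrightarrow> continuous_on UNIV (stiffness_hom \<alpha> km kp)"
  unfolding stiffness_hom_def[abs_def] by (intro continuous_intros) auto

lemma C2_realI:
  fixes u :: "real \<Rightarrow> real"
  assumes "\<And>t. (u has_real_derivative u' t) (at t)" "\<And>t. (u' has_real_derivative u'' t) (at t)"
    "continuous_on UNIV u''"
  shows "C2 u"
  unfolding C2_def C1_differentiable_on_def
  using assms by (auto simp: has_real_derivative_iff_has_vector_derivative)

lemma C2_V_hom: "\<alpha> > 1 \<Longrightarrow> C2 (V_hom \<alpha> km kp)"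
  using has_derivative_V_hom has_derivative_force_hom continuous_stiffness_hom by (rule C2_realI)

lemma C2_zero: "C2 (\<lambda>_::real. 0::real)"
  by (rule C2_realI[where u' = "\<lambda>_. 0" and u'' = "\<lambda>_. 0"]) auto

lemma stiffness_hom_bound:
  assumes "\<alpha> > 1"
  shows "\<bar>stiffness_hom \<alpha> km kp r\<bar> \<le> \<alpha> * (\<bar>km\<bar> + \<bar>kp\<bar>) * \<bar>r\<bar> powr (\<alpha> - 1)"
proof -
  have "\<bar>kp * \<alpha> * pos_powr (\<alpha> - 1) r\<bar> \<le> \<bar>kp\<bar> * \<alpha> * \<bar>r\<bar> powr (\<alpha> - 1)"
    unfolding abs_mult using assms pos_powr_le[of "\<alpha> - 1" r] by (auto intro!: mult_mono)
  moreover have "\<bar>km * \<alpha> * pos_powr (\<alpha> - 1) (- r)\<bar> \<le> \<bar>km\<bar> * \<alpha> * \<bar>r\<bar> powr (\<alpha> - 1)"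
    unfolding abs_mult using assms pos_powr_le[of "\<alpha> - 1" "- r"] by (auto intro!: mult_mono)
  ultimately show ?thesis unfolding stiffness_hom_def by (simp add: algebra_simps abs_triangle_ineq[THEN order_trans])
qed

text \<open>
  The derivative of \<open>a \<mapsto> \<integral> {a..a + p} f\<close> is \<open>f (a + p) - f a = 0\<close>.
\<close>

lemma integral_over_period:
  fixes f :: "real \<Rightarrow> real"
  assumes cont: "continuous_on UNIV f" and per: "\<And>t. f (t + p) = f t" and p: "p \<ge> 0"
  shows "integral {a..a + p} f = integral {b..b + p} f"
proof -
  define c where "c = min a b - 1"
  define d where "d = max a b + p + 1"
  define F where "F = (\<lambda>x. integral {c..x} f)"
  have cont': "continuous_on S f" for S using cont continuous_on_subset by blast
  have eq: "integral {x..x + p} f = F (x + p) - F x" if "x \<ge> c" for x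
    using Henstock_Kurzweil_Integration.integral_combine[of c x "x + p" f] that p
    by (simp add: F_def integrable_continuous_real[OF cont'])
  have F: "(F has_real_derivative f y) (at y)" if "c < y" "y < d" for y
    using integral_has_vector_derivative[OF cont', of y c d] that
    by (simp add: F_def has_real_derivative_iff_has_vector_derivative at_within_Icc_at)
  have "F (a + p) - F a = F (b + p) - F b"
  proof (rule DERIV_isconst3[where f = "\<lambda>x. F (x + p) - F x"])
    show "c < d - p" "a \<in> {c<..<d - p}" "b \<in> {c<..<d - p}" by (auto simp: c_def d_def)
    fix x assume x: "x \<in> {c<..<d - p}"
    have "((\<lambda>x. F (x + p) - F x) has_real_derivative f (x + p) - f x) (at x)"
      using x p by (intro DERIV_diff F) (auto simp flip: DERIV_shift intro!: F)
    thus "((\<lambda>x. F (x + p) - F x) has_real_derivative 0) (at x)" by (simp add: per)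
  qed
  thus ?thesis by (simp add: eq c_def)
qed

text \<open>
  The substitution \<open>t = (sin s)\<^sup>2\<close> turns the Beta integral with parameters \<open>1/2\<close> and \<open>\<alpha> / 2 + 1\<close> into this
  one. Since the Beta integrand is singular at \<open>0\<close>, the change of variables is made for absolutely
  integrable functions.
\<close>

lemma has_integral_cos_powr:
  assumes "\<alpha> > 0"
  shows "((\<lambda>s. 2 * cos s powr (\<alpha> + 1)) has_integral Beta (1/2) (\<alpha> / 2 + 1)) {0..pi/2}"
proof -
  \<comment> \<open>The substituted integrand agrees with the claimed one except at \<open>s = 0\<close>, where \<open>0 powr (- 1/2) = 0\<close>.\<close>
  let ?f = "\<lambda>t::real. t powr (1/2 - 1) * (1 - t) powr (\<alpha> / 2 + 1 - 1)"
  let ?g = "\<lambda>s::real. (sin s)\<^sup>2"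
  have img: "?g ` {0..pi/2} = {0..1}"
  proof
    show "?g ` {0..pi/2} \<subseteq> {0..1}" by (auto simp: power_le_one_iff abs_square_le_1)
    show "{0..1} \<subseteq> ?g ` {0..pi/2}"
    proof
      fix t :: real assume t: "t \<in> {0..1}"
      hence r: "0 \<le> sqrt t" "sqrt t \<le> 1" by auto
      hence m: "-1 \<le> sqrt t" by linarith
      have "t = ?g (arcsin (sqrt t))" using r m t by (subst sin_arcsin) auto
      moreover have "arcsin (sqrt t) \<in> {0..pi/2}"
        using r m arcsin_ubound[of "sqrt t"] arcsin_le_arcsin[of 0 "sqrt t"] by auto
      ultimately
      show "t \<in> ?g ` {0..pi/2}" by blast
    qed
  qed
  have inj: "inj_on ?g {0..pi/2}"
  proof (rule inj_onI)
    fix x y assume xy: "x \<in> {0..pi/2}" "y \<in> {0..pi/2}" "(sin x)\<^sup>2 = (sin y)\<^sup>2"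
    have pos: "sin x \<ge> 0" "sin y \<ge> 0" using xy(1,2) pi_gt_zero by (auto intro!: sin_ge_zero)
    have "sin x = sin y" by (rule power2_eq_imp_eq[OF xy(3) pos])
    moreover have "\<bar>x\<bar> \<le> pi/2" "\<bar>y\<bar> \<le> pi/2" using xy(1,2) by auto
    ultimately show "x = y" using sin_inj_pi[of x y] by (auto simp: abs_le_iff)
  qed
  have B: "(?f has_integral Beta (1/2) (\<alpha> / 2 + 1)) {0..1}"
    using assms by (intro has_integral_Beta_real) auto
  hence "?f absolutely_integrable_on {0..1}"
    by (intro nonnegative_absolutely_integrable_1) auto
  hence "?f absolutely_integrable_on ?g ` {0..pi/2} \<and> integral (?g ` {0..pi/2}) ?f = Beta (1/2) (\<alpha> / 2 + 1)"
    using B by (simp add: img integral_unique)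
  hence "(\<lambda>s. \<bar>2 * sin s * cos s\<bar> * ?f (?g s)) absolutely_integrable_on {0..pi/2} \<and>
      integral {0..pi/2} (\<lambda>s. \<bar>2 * sin s * cos s\<bar> * ?f (?g s)) = Beta (1/2) (\<alpha> / 2 + 1)"
    by (subst has_absolute_integral_change_of_variables_1'[where g = ?g])
      (auto intro!: derivative_eq_intros inj)
  hence "((\<lambda>s. \<bar>2 * sin s * cos s\<bar> * ?f (?g s)) has_integral Beta (1/2) (\<alpha> / 2 + 1)) {0..pi/2}"
    using has_integral_iff set_lebesgue_integral_eq_integral(1) by blast
  thus ?thesis
  proof (rule has_integral_spike_finite[of "{0}", rotated 2])
    fix s assume "s \<in> {0..pi/2} - {0}"
    hence s: "0 < s" "s \<le> pi/2" by auto
    have pos: "sin s > 0" "cos s \<ge> 0" using s by (auto intro!: sin_gt_zero cos_ge_zero)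
    have "(sin s)\<^sup>2 powr (1/2 - 1) = (sin s)\<^sup>2 powr - (1/2)" by simp
    also have "\<dots> = inverse (sin s)"
      unfolding powr_minus using pos by (simp add: powr_half_sqrt)
    finally have "(sin s)\<^sup>2 powr (1/2 - 1) = inverse (sin s)" .
    moreover have "(1 - (sin s)\<^sup>2) powr (\<alpha> / 2 + 1 - 1) = cos s powr \<alpha>"
    proof (cases "cos s = 0")
      case False
      hence "cos s > 0" using pos by simp
      hence "(cos s powr 2) powr (\<alpha> / 2) = cos s powr \<alpha>" by (simp only: powr_powr) simp
      thus ?thesis using \<open>cos s > 0\<close> by (simp add: powr_numeral cos_squared_eq)
    qed (use cos_squared_eq[of s] assms in simp)
    moreover have "cos s powr (\<alpha> + 1) = cos s * cos s powr \<alpha>"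
      using pos by (cases "cos s = 0") (auto simp: powr_add)
    ultimately show "2 * cos s powr (\<alpha> + 1) = \<bar>2 * sin s * cos s\<bar> * ?f (?g s)"
      using pos by (simp add: abs_mult field_simps)
  qed simp
qed

text \<open>
  The integrand has the periodic antiderivative \<open>- pos_powr (\<alpha> + 1) (cos s) / (\<alpha> + 1)\<close>.
\<close>

lemma integral_pos_powr_cos_sin:
  assumes "\<alpha> > 1"
  shows "integral {0..2*pi} (\<lambda>s. pos_powr \<alpha> (cos s) * sin s) = 0"
proof -
  have "((\<lambda>s. pos_powr \<alpha> (cos s) * sin s) has_integral
      (- pos_powr (\<alpha> + 1) (cos (2*pi)) / (\<alpha> + 1)) - (- pos_powr (\<alpha> + 1) (cos 0) / (\<alpha> + 1))) {0..2*pi}"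
  proof (rule fundamental_theorem_of_calculus)
    fix s :: real
    have "((\<lambda>s. pos_powr (\<alpha> + 1) (cos s)) has_real_derivative
        (\<alpha> + 1) * pos_powr (\<alpha> + 1 - 1) (cos s) * (- sin s)) (at s within {0..2*pi})"
      using assms by (intro DERIV_chain2[OF has_real_derivative_pos_powr]) (auto intro!: derivative_eq_intros)
    from DERIV_cdivide[OF DERIV_minus[OF this], of "\<alpha> + 1"]
    show "((\<lambda>s. - pos_powr (\<alpha> + 1) (cos s) / (\<alpha> + 1)) has_vector_derivative pos_powr \<alpha> (cos s) * sin s)
        (at s within {0..2*pi})"
      using assms by (simp add: has_real_derivative_iff_has_vector_derivative)
  qed simp
  thus ?thesis by (simp add: integral_unique)
qed

lemma integral_pos_powr_cos_cos:
  assumes "\<alpha> > 1"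
  shows "integral {0..2*pi} (\<lambda>s. pos_powr \<alpha> (cos s) * cos s) = Beta (1/2) (\<alpha> / 2 + 1)"
proof -
  let ?h = "\<lambda>s. pos_powr (\<alpha> + 1) (cos s)"
  have h: "(\<lambda>s. pos_powr \<alpha> (cos s) * cos s) = ?h"
    using assms by (intro ext pos_powr_times_self) auto
  have cont: "continuous_on S ?h" for S using assms by (intro continuous_intros) auto
  have int: "?h integrable_on {a..b}" for a b by (rule integrable_continuous_real[OF cont])
  have right: "(?h has_integral Beta (1/2) (\<alpha> / 2 + 1) / 2) {0..pi/2}"
  proof -
    have "((\<lambda>s. 1/2 * (2 * cos s powr (\<alpha> + 1))) has_integral 1/2 * Beta (1/2) (\<alpha> / 2 + 1)) {0..pi/2}"
      using assms by (intro has_integral_mult_right has_integral_cos_powr) auto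
    hence "((\<lambda>s. cos s powr (\<alpha> + 1)) has_integral Beta (1/2) (\<alpha> / 2 + 1) / 2) {0..pi/2}" by simp
    thus ?thesis
      by (rule has_integral_eq[rotated]) (auto simp: pos_powr_def cos_ge_zero)
  qed
  have left: "(?h has_integral Beta (1/2) (\<alpha> / 2 + 1) / 2) {-(pi/2)..0}"
    using iffD2[OF has_integral_reflect_real[where f = ?h], OF right] by simp
  have zero: "(?h has_integral 0) {pi/2..3*pi/2}"
  proof (rule has_integral_is_0)
    fix s assume "s \<in> {pi/2..3*pi/2}"
    hence "cos (s - pi) \<ge> 0" by (intro cos_ge_zero) auto
    thus "?h s = 0" by (simp add: pos_powr_def max_def)
  qed
  have "(?h has_integral (Beta (1/2) (\<alpha> / 2 + 1) / 2 + Beta (1/2) (\<alpha> / 2 + 1) / 2) + 0) {-(pi/2)..3*pi/2}"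
    by (rule has_integral_combine[OF _ _ has_integral_combine[OF _ _ left right] zero]) auto
  moreover have "-(pi/2) + 2*pi = 3*pi/2" by simp
  ultimately have "integral {-(pi/2)..-(pi/2) + 2*pi} ?h = Beta (1/2) (\<alpha> / 2 + 1)"
    by (metis (no_types, lifting) add.right_neutral field_sum_of_halves integral_unique)
  moreover have "integral {0..0 + 2*pi} ?h = integral {-(pi/2)..-(pi/2) + 2*pi} ?h"
    by (intro integral_over_period cont) auto
  ultimately show ?thesis by (simp add: h)
qed

text \<open>
  After shifting the period, the addition theorems leave one multiple of the mean against \<open>cos\<close> and one
  multiple of the mean against \<open>sin\<close>; the latter is zero.
\<close>

lemma integral_pos_powr_cos_shifted:
  assumes "\<alpha> > 1"
  shows "integral {a..a + 2*pi} (\<lambda>s. pos_powr \<alpha> (cos (s - \<theta>)) * cos s) = Beta (1/2) (\<alpha> / 2 + 1) * cos \<theta>"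
    and "integral {a..a + 2*pi} (\<lambda>s. pos_powr \<alpha> (cos (s - \<theta>)) * sin s) = Beta (1/2) (\<alpha> / 2 + 1) * sin \<theta>"
proof -
  let ?Q = "Beta (1/2) (\<alpha> / 2 + 1)"
  have int: "(\<lambda>s. pos_powr \<alpha> (cos s) * cos s) integrable_on {c..d}"
    "(\<lambda>s. pos_powr \<alpha> (cos s) * sin s) integrable_on {c..d}" for c d :: real
    using assms by (intro integrable_continuous_real continuous_intros; simp)+
  have shifted: "integral {a..a + 2*pi} (\<lambda>s. pos_powr \<alpha> (cos (s - \<theta>)) * g s)
      = integral {0..2*pi} (\<lambda>s. pos_powr \<alpha> (cos s) * g (s + \<theta>))"
    if g: "continuous_on UNIV g" "\<And>s. g (s + 2*pi) = g s" for g :: "real \<Rightarrow> real"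
  proof -
    have "cos (s + 2*pi - \<theta>) = cos (s - \<theta>)" for s
      using cos_periodic[of "s - \<theta>"] by (simp add: algebra_simps)
    hence "integral {a..a + 2*pi} (\<lambda>s. pos_powr \<alpha> (cos (s - \<theta>)) * g s)
        = integral {\<theta>..\<theta> + 2*pi} (\<lambda>s. pos_powr \<alpha> (cos (s - \<theta>)) * g s)"
      using assms g by (intro integral_over_period continuous_intros) auto
    also have "\<dots> = integral {0..2*pi} (\<lambda>s. pos_powr \<alpha> (cos s) * g (s + \<theta>))"
      using integral_shift_real_ivl[of \<theta> \<theta> "\<theta> + 2*pi" "\<lambda>s. pos_powr \<alpha> (cos (s - \<theta>)) * g s"]
      by simp
    finally show ?thesis .
  qed
  have "integral {a..a + 2*pi} (\<lambda>s. pos_powr \<alpha> (cos (s - \<theta>)) * cos s)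
      = integral {0..2*pi} (\<lambda>s. pos_powr \<alpha> (cos s) * cos s * cos \<theta> - pos_powr \<alpha> (cos s) * sin s * sin \<theta>)"
    by (subst shifted) (auto simp: cos_add algebra_simps intro!: continuous_intros)
  also have "\<dots> = ?Q * cos \<theta> - 0 * sin \<theta>"
    by (subst Henstock_Kurzweil_Integration.integral_diff)
      (auto intro!: integrable_on_mult_left int
        simp: integral_pos_powr_cos_cos[OF assms] integral_pos_powr_cos_sin[OF assms])
  finally show "integral {a..a + 2*pi} (\<lambda>s. pos_powr \<alpha> (cos (s - \<theta>)) * cos s) = ?Q * cos \<theta>" by simp
  have "integral {a..a + 2*pi} (\<lambda>s. pos_powr \<alpha> (cos (s - \<theta>)) * sin s)
      = integral {0..2*pi} (\<lambda>s. pos_powr \<alpha> (cos s) * sin s * cos \<theta> + pos_powr \<alpha> (cos s) * cos s * sin \<theta>)"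
    by (subst shifted) (auto simp: sin_add algebra_simps intro!: continuous_intros)
  also have "\<dots> = 0 * cos \<theta> + ?Q * sin \<theta>"
    by (subst Henstock_Kurzweil_Integration.integral_add)
      (auto intro!: integrable_on_mult_left int
        simp: integral_pos_powr_cos_cos[OF assms] integral_pos_powr_cos_sin[OF assms])
  finally show "integral {a..a + 2*pi} (\<lambda>s. pos_powr \<alpha> (cos (s - \<theta>)) * sin s) = ?Q * sin \<theta>" by simp
qed

text \<open>
  In polar coordinates \<open>(u, v) = (\<rho> * cos \<theta>, \<rho> * sin \<theta>)\<close> the argument of the force is
  \<open>\<rho> * cos (s - \<theta>)\<close>. Homogeneity extracts \<open>\<rho> powr \<alpha>\<close>. The branch for negative arguments is the
  branch for positive ones with \<open>\<theta>\<close> replaced by \<open>\<theta> + pi\<close>, so both stiffnesses contribute the same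
  multiple and only \<open>km + kp\<close> survives.
\<close>

lemma integral_force_hom:
  assumes "\<alpha> > 1"
  shows "integral {a..a + 2*pi} (\<lambda>s. force_hom \<alpha> km kp (cos s * u + sin s * v) * cos s)
      = (km + kp) * Beta (1/2) (\<alpha> / 2 + 1) * (sqrt (u\<^sup>2 + v\<^sup>2) powr (\<alpha> - 1) * u)"
    and "integral {a..a + 2*pi} (\<lambda>s. force_hom \<alpha> km kp (cos s * u + sin s * v) * sin s)
      = (km + kp) * Beta (1/2) (\<alpha> / 2 + 1) * (sqrt (u\<^sup>2 + v\<^sup>2) powr (\<alpha> - 1) * v)"
proof -
  define \<rho> where "\<rho> = sqrt (u\<^sup>2 + v\<^sup>2)"
  have \<rho>: "\<rho> \<ge> 0" by (simp add: \<rho>_def)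
  have "rcis \<rho> (Arg (Complex u v)) = Complex u v"
    using rcis_cmod_Arg[of "Complex u v"] by (simp add: \<rho>_def complex_norm)
  then obtain \<theta> where \<theta>: "u = \<rho> * cos \<theta>" "v = \<rho> * sin \<theta>"
    by (metis Re_rcis Im_rcis complex.sel)
  have \<rho>_powr: "\<rho> powr (\<alpha> - 1) * \<rho> = \<rho> powr \<alpha>"
    using \<rho> by (cases "\<rho> = 0") (auto simp: powr_diff)
  have split: "force_hom \<alpha> km kp (cos s * u + sin s * v)
      = \<rho> powr \<alpha> * (kp * pos_powr \<alpha> (cos (s - \<theta>)) - km * pos_powr \<alpha> (cos (s - (\<theta> + pi))))" for s
  proof -
    have 1: "cos s * u + sin s * v = \<rho> * cos (s - \<theta>)"
      by (simp add: \<theta> cos_diff algebra_simps)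
    have 2: "cos (s - (\<theta> + pi)) = - cos (s - \<theta>)"
      by (simp add: cos_diff cos_add sin_add)
    show ?thesis
      using pos_powr_mult[OF \<rho>, of \<alpha> "cos (s - \<theta>)"] pos_powr_mult[OF \<rho>, of \<alpha> "- cos (s - \<theta>)"]
      unfolding 1 2 force_hom_def by (simp add: algebra_simps)
  qed
  have int: "(\<lambda>s. pos_powr \<alpha> (cos (s - \<tau>)) * cos s) integrable_on {c..d}"
    "(\<lambda>s. pos_powr \<alpha> (cos (s - \<tau>)) * sin s) integrable_on {c..d}" for c d \<tau> :: real
    using assms by (intro integrable_continuous_real continuous_intros; simp)+
  note shifted = integral_pos_powr_cos_shifted[OF assms]
  have "integral {a..a + 2*pi} (\<lambda>s. force_hom \<alpha> km kp (cos s * u + sin s * v) * cos s)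
      = integral {a..a + 2*pi} (\<lambda>s. (\<rho> powr \<alpha> * kp) * (pos_powr \<alpha> (cos (s - \<theta>)) * cos s)
          - (\<rho> powr \<alpha> * km) * (pos_powr \<alpha> (cos (s - (\<theta> + pi))) * cos s))"
    unfolding split by (simp add: algebra_simps)
  also have "\<dots> = (\<rho> powr \<alpha> * kp) * (Beta (1/2) (\<alpha> / 2 + 1) * cos \<theta>)
      - (\<rho> powr \<alpha> * km) * (Beta (1/2) (\<alpha> / 2 + 1) * cos (\<theta> + pi))"
    by (simp only: Henstock_Kurzweil_Integration.integral_diff integral_mult_right
        integrable_on_mult_right int shifted)
  also have "\<dots> = (km + kp) * Beta (1/2) (\<alpha> / 2 + 1) * (\<rho> powr (\<alpha> - 1) * u)"
    unfolding \<theta>(1) \<rho>_powr[symmetric] by (simp add: algebra_simps)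
  finally show "integral {a..a + 2*pi} (\<lambda>s. force_hom \<alpha> km kp (cos s * u + sin s * v) * cos s)
      = (km + kp) * Beta (1/2) (\<alpha> / 2 + 1) * (sqrt (u\<^sup>2 + v\<^sup>2) powr (\<alpha> - 1) * u)"
    by (simp add: \<rho>_def)
  have "integral {a..a + 2*pi} (\<lambda>s. force_hom \<alpha> km kp (cos s * u + sin s * v) * sin s)
      = integral {a..a + 2*pi} (\<lambda>s. (\<rho> powr \<alpha> * kp) * (pos_powr \<alpha> (cos (s - \<theta>)) * sin s)
          - (\<rho> powr \<alpha> * km) * (pos_powr \<alpha> (cos (s - (\<theta> + pi))) * sin s))"
    unfolding split by (simp add: algebra_simps)
  also have "\<dots> = (\<rho> powr \<alpha> * kp) * (Beta (1/2) (\<alpha> / 2 + 1) * sin \<theta>)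
      - (\<rho> powr \<alpha> * km) * (Beta (1/2) (\<alpha> / 2 + 1) * sin (\<theta> + pi))"
    by (simp only: Henstock_Kurzweil_Integration.integral_diff integral_mult_right
        integrable_on_mult_right int shifted)
  also have "\<dots> = (km + kp) * Beta (1/2) (\<alpha> / 2 + 1) * (\<rho> powr (\<alpha> - 1) * v)"
    unfolding \<theta>(2) \<rho>_powr[symmetric] by (simp add: algebra_simps)
  finally show "integral {a..a + 2*pi} (\<lambda>s. force_hom \<alpha> km kp (cos s * u + sin s * v) * sin s)
      = (km + kp) * Beta (1/2) (\<alpha> / 2 + 1) * (sqrt (u\<^sup>2 + v\<^sup>2) powr (\<alpha> - 1) * v)"
    by (simp add: \<rho>_def)
qed

text \<open>
  The quotient of Gamma functions in \<open>omega0\<close> is the mean just computed. The factor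
  \<open>2 powr ((\<alpha> - 1) / 2)\<close> reflects that the modulus of the complex amplitude is the real one divided by
  \<open>sqrt 2\<close>.
\<close>

lemma omega0_conv_Beta:
  assumes "\<alpha> > 1"
  shows "omega0 \<alpha> km kp = 2 powr ((\<alpha> - 1) / 2) * ((km + kp) * Beta (1/2) (\<alpha> / 2 + 1) / (2 * pi))"
proof -
  have G1: "Gamma (\<alpha> / 2 + 1) = \<alpha> / 2 * Gamma (\<alpha> / 2)"
    using assms by (intro Gamma_plus1) (auto simp: nonpos_Ints_def)
  have "1 / 2 + (\<alpha> / 2 + 1) = (\<alpha> + 1) / 2 + 1" by (simp add: field_simps)
  moreover have "Gamma ((\<alpha> + 1) / 2 + 1) = (\<alpha> + 1) / 2 * Gamma ((\<alpha> + 1) / 2)"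
    using assms by (intro Gamma_plus1) (auto simp: nonpos_Ints_def)
  ultimately have B: "Beta (1/2) (\<alpha> / 2 + 1)
      = sqrt pi * (\<alpha> / 2 * Gamma (\<alpha> / 2)) / ((\<alpha> + 1) / 2 * Gamma ((\<alpha> + 1) / 2))"
    by (simp add: Beta_def G1 Gamma_one_half_real)
  have "2 powr ((\<alpha> - 3) / 2) = 2 powr ((\<alpha> - 1) / 2 - 1)" by (simp add: field_simps)
  hence p: "2 powr ((\<alpha> - 3) / 2) = 2 powr ((\<alpha> - 1) / 2) / 2" by (simp add: powr_diff)
  have G: "Gamma ((\<alpha> + 1) / 2) > 0" using assms by (intro Gamma_real_pos) auto
  define q where "q = sqrt pi"
  have q: "q > 0" "pi = q * q" by (simp_all add: q_def)
  have "(km + kp) * (z / 2) * (\<alpha> * G / (q * (\<alpha> + 1) * H))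
      = z * ((km + kp) * (q * (\<alpha> / 2 * G) / ((\<alpha> + 1) / 2 * H)) / (2 * (q * q)))" if "H > 0" for z G H
    using assms that q(1) by (simp add: divide_simps) (simp add: algebra_simps)?
  from this[OF G] show ?thesis
    unfolding omega0_def B p q_def[symmetric] q(2)[symmetric] .
qed

section \<open>Lipschitz estimates for the lattice force\<close>

lemma ell2_map_lipschitz:
  assumes nth: "\<And>x n. ell2_nth (ell2_map g x) n = g (ell2_nth x n)"
    and M: "M \<ge> 0" and lip: "\<And>a b. norm a \<le> \<rho> \<Longrightarrow> norm b \<le> \<rho> \<Longrightarrow> norm (g a - g b) \<le> M * norm (a - b)"
    and x: "norm x \<le> \<rho>" and y: "norm y \<le> \<rho>"
  shows "norm (ell2_map g x - ell2_map g y) \<le> M * norm (x - y)"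
proof (rule norm_ell2_mono[OF M])
  fix n
  have "norm (ell2_nth x n) \<le> \<rho>" "norm (ell2_nth y n) \<le> \<rho>"
    using norm_ell2_nth_le[of x n] norm_ell2_nth_le[of y n] x y by linarith+
  thus "norm (ell2_nth (ell2_map g x - ell2_map g y) n) \<le> M * norm (ell2_nth (x - y) n)"
    using lip by (simp add: nth)
qed

lemma deriv_lipschitz_C2:
  fixes u :: "real \<Rightarrow> real"
  assumes "C2 u" and bound: "\<And>r. \<bar>r\<bar> \<le> \<rho> \<Longrightarrow> \<bar>deriv (deriv u) r\<bar> \<le> M"
    and "\<bar>a\<bar> \<le> \<rho>" "\<bar>b\<bar> \<le> \<rho>"
  shows "\<bar>deriv u a - deriv u b\<bar> \<le> M * \<bar>a - b\<bar>"
proof -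
  have "norm (deriv u a - deriv u b) \<le> M * norm (a - b)"
  proof (rule field_differentiable_bound[where S = "{-\<rho>..\<rho>}" and f' = "deriv (deriv u)"])
    show "(deriv u has_field_derivative deriv (deriv u) z) (at z within {-\<rho>..\<rho>})" for z
      using C2_realD(2)[OF assms(1)] has_field_derivative_at_within by blast
  qed (use assms in auto)
  thus ?thesis by simp
qed

text \<open>
  The difference operators have norm at most two. Hence the bond variables range up to \<open>2 * \<rho>\<close>, and the
  factor is \<open>5 = 2 * 2 + 1\<close>, with \<open>1\<close> for the on-site force.
\<close>

lemma lattice_F_lipschitz:
  assumes V: "C2 V" "deriv V 0 = 0" and \<phi>: "C2 \<phi>" "deriv \<phi> 0 = 0" and M: "M \<ge> 0"
    and bV: "\<And>r. \<bar>r\<bar> \<le> 2 * \<rho> \<Longrightarrow> \<bar>deriv (deriv V) r\<bar> \<le> M"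
    and b\<phi>: "\<And>r. \<bar>r\<bar> \<le> 2 * \<rho> \<Longrightarrow> \<bar>deriv (deriv \<phi>) r\<bar> \<le> M"
    and x: "norm x \<le> \<rho>" and y: "norm y \<le> \<rho>"
  shows "norm (lattice_F V \<phi> x - lattice_F V \<phi> y) \<le> 5 * M * norm (x - y)"
proof -
  let ?a = "ell2_map (deriv V) (delta_minus x)" and ?b = "ell2_map (deriv V) (delta_minus y)"
  have "norm (?a - ?b) \<le> M * norm (delta_minus x - delta_minus y)"
  proof (rule ell2_map_lipschitz[OF _ M, where \<rho> = "2 * \<rho>"])
    show "norm (delta_minus x) \<le> 2 * \<rho>" "norm (delta_minus y) \<le> 2 * \<rho>"
      using norm_delta_minus_le[of x] norm_delta_minus_le[of y] x y by linarith+
    show "norm (deriv V a - deriv V b) \<le> M * norm (a - b)" if "norm a \<le> 2 * \<rho>" "norm b \<le> 2 * \<rho>" for a b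
      using deriv_lipschitz_C2[OF V(1) bV] that by simp
    show "\<And>x n. ell2_nth (ell2_map (deriv V) x) n = deriv V (ell2_nth x n)"
      by (rule ell2_nth_map_differentiable[OF V(2) C2_realD(2)[OF V(1)]])
  qed
  also have "delta_minus x - delta_minus y = delta_minus (x - y)" by (intro ell2_eqI) simp
  also have "M * norm (delta_minus (x - y)) \<le> M * (2 * norm (x - y))"
    using M norm_delta_minus_le by (intro mult_left_mono) auto
  finally have 1: "norm (?a - ?b) \<le> M * (2 * norm (x - y))" .
  have 2: "norm (ell2_map (deriv \<phi>) x - ell2_map (deriv \<phi>) y) \<le> M * norm (x - y)"
  proof (rule ell2_map_lipschitz[OF _ M, where \<rho> = \<rho>])
    show "norm (deriv \<phi> a - deriv \<phi> b) \<le> M * norm (a - b)" if "norm a \<le> \<rho>" "norm b \<le> \<rho>" for a b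
      using deriv_lipschitz_C2[OF \<phi>(1), of \<rho> M a b] b\<phi> that by force
    show "\<And>x n. ell2_nth (ell2_map (deriv \<phi>) x) n = deriv \<phi> (ell2_nth x n)"
      by (rule ell2_nth_map_differentiable[OF \<phi>(2) C2_realD(2)[OF \<phi>(1)]])
  qed (use x y in auto)
  have "lattice_F V \<phi> x - lattice_F V \<phi> y
      = delta_plus (?a - ?b) - (ell2_map (deriv \<phi>) x - ell2_map (deriv \<phi>) y)"
    unfolding lattice_F_def by (intro ell2_eqI) simp
  hence "norm (lattice_F V \<phi> x - lattice_F V \<phi> y)
      \<le> norm (delta_plus (?a - ?b)) + norm (ell2_map (deriv \<phi>) x - ell2_map (deriv \<phi>) y)"
    by (simp only: norm_triangle_ineq4)
  thus ?thesis using norm_delta_plus_le[of "?a - ?b"] 1 2 by (simp add: algebra_simps)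
qed

lemma lattice_F_zero:
  assumes "C2 V" "deriv V 0 = 0" "C2 \<phi>" "deriv \<phi> 0 = 0"
  shows "lattice_F V \<phi> 0 = 0"
  by (rule ell2_eqI) (simp add: ell2_nth_lattice_F[OF assms] assms(2,4))

lemma lattice_F_locally_lipschitz:
  assumes V: "C2 V" "deriv V 0 = 0" and \<phi>: "C2 \<phi>" "deriv \<phi> 0 = 0"
  obtains L where "L \<ge> 0" "\<And>x y. norm x \<le> \<rho> \<Longrightarrow> norm y \<le> \<rho> \<Longrightarrow>
    norm (lattice_F V \<phi> x - lattice_F V \<phi> y) \<le> L * norm (x - y)"
proof -
  have ex: "\<exists>M. \<forall>r\<in>{-2*\<rho>..2*\<rho>}. \<bar>deriv (deriv u) r\<bar> \<le> M" if "C2 u" for u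
  proof -
    have "compact (deriv (deriv u) ` {-2*\<rho>..2*\<rho>})"
      by (intro compact_continuous_image continuous_on_subset[OF C2_realD(3)[OF that]]) auto
    from compact_imp_bounded[OF this] show ?thesis by (force simp: bounded_iff)
  qed
  obtain M1 M2 where M: "\<And>r. r \<in> {-2*\<rho>..2*\<rho>} \<Longrightarrow> \<bar>deriv (deriv V) r\<bar> \<le> M1"
    "\<And>r. r \<in> {-2*\<rho>..2*\<rho>} \<Longrightarrow> \<bar>deriv (deriv \<phi>) r\<bar> \<le> M2"
    using ex[OF V(1)] ex[OF \<phi>(1)] by blast
  let ?M = "max 0 (max M1 M2)"
  show ?thesis
  proof (rule that[of "5 * ?M"])
    fix x y :: "real ell2" assume "norm x \<le> \<rho>" "norm y \<le> \<rho>"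
    thus "norm (lattice_F V \<phi> x - lattice_F V \<phi> y) \<le> 5 * ?M * norm (x - y)"
      using M by (intro lattice_F_lipschitz[OF V \<phi>, where \<rho> = \<rho>]) (auto simp: abs_le_iff le_max_iff_disj)
  qed simp
qed

lemma continuous_on_lattice_F:
  assumes V: "C2 V" "deriv V 0 = 0" and \<phi>: "C2 \<phi>" "deriv \<phi> 0 = 0"
  shows "continuous_on S (lattice_F V \<phi>)"
proof (rule continuous_on_subset[OF _ subset_UNIV], rule continuous_at_imp_continuous_on, rule ballI)
  fix x :: "real ell2"
  obtain L where L: "L \<ge> 0" "\<And>y z. norm y \<le> norm x + 1 \<Longrightarrow> norm z \<le> norm x + 1 \<Longrightarrow>
      norm (lattice_F V \<phi> y - lattice_F V \<phi> z) \<le> L * norm (y - z)"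
    using lattice_F_locally_lipschitz[OF V \<phi>] by blast
  have "L-lipschitz_on (ball x 1) (lattice_F V \<phi>)"
  proof (rule lipschitz_onI)
    fix y z assume "y \<in> ball x 1" "z \<in> ball x 1"
    hence "norm y \<le> norm x + 1" "norm z \<le> norm x + 1"
      using norm_triangle_ineq2[of y x] norm_triangle_ineq2[of z x] by (auto simp: dist_norm norm_minus_commute)
    thus "dist (lattice_F V \<phi> y) (lattice_F V \<phi> z) \<le> L * dist y z"
      using L(2) by (simp add: dist_norm)
  qed (rule L)
  hence "continuous_on (ball x 1) (lattice_F V \<phi>)" by (rule lipschitz_on_continuous_on)
  thus "isCont (lattice_F V \<phi>) x" by (simp add: continuous_on_eq_continuous_at)
qed

lemma lattice_F_powr_lipschitz:
  assumes V: "C2 V" "deriv V 0 = 0" and \<phi>: "C2 \<phi>" "deriv \<phi> 0 = 0" and C: "C \<ge> 0" and p: "p \<ge> 0"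
    and bV: "\<And>r. \<bar>r\<bar> \<le> d \<Longrightarrow> \<bar>deriv (deriv V) r\<bar> \<le> C * \<bar>r\<bar> powr p"
    and b\<phi>: "\<And>r. \<bar>r\<bar> \<le> d \<Longrightarrow> \<bar>deriv (deriv \<phi>) r\<bar> \<le> C * \<bar>r\<bar> powr p"
    and \<rho>: "2 * \<rho> \<le> d" and x: "norm x \<le> \<rho>" and y: "norm y \<le> \<rho>"
  shows "norm (lattice_F V \<phi> x - lattice_F V \<phi> y) \<le> 5 * C * (2 * \<rho>) powr p * norm (x - y)"
proof -
  have mono: "C * \<bar>r\<bar> powr p \<le> C * (2 * \<rho>) powr p" if "\<bar>r\<bar> \<le> 2 * \<rho>" for r
    using that C p by (intro mult_left_mono powr_mono2) auto
  have "norm (lattice_F V \<phi> x - lattice_F V \<phi> y) \<le> 5 * (C * (2 * \<rho>) powr p) * norm (x - y)"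
    by (rule lattice_F_lipschitz[OF V \<phi> _ _ _ x y])
      (use C \<rho> order_trans[OF bV mono] order_trans[OF b\<phi> mono] in auto)
  thus ?thesis by (simp add: mult.assoc)
qed

text \<open>
  The hypotheses speak of a punctured neighbourhood of the origin; continuity forces \<open>g 0 = 0\<close> and so
  extends the bound to the origin itself.
\<close>

lemma bigo_powr_imp_bound:
  fixes g :: "real \<Rightarrow> real"
  assumes g: "g \<in> O[at 0](\<lambda>r. \<bar>r\<bar> powr p)" and cont: "continuous_on UNIV g" and p: "p > 0"
  obtains C d where "C > 0" "d > 0" "\<And>r. \<bar>r\<bar> \<le> d \<Longrightarrow> \<bar>g r\<bar> \<le> C * \<bar>r\<bar> powr p"
proof -
  obtain C where C: "C > 0" "\<forall>\<^sub>F r in at 0. norm (g r) \<le> C * norm (\<bar>r\<bar> powr p)"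
    using g by (elim landau_o.bigE) auto
  then obtain d where d: "d > 0" "\<And>r. r \<noteq> 0 \<Longrightarrow> \<bar>r\<bar> < d \<Longrightarrow> \<bar>g r\<bar> \<le> C * \<bar>r\<bar> powr p"
    unfolding eventually_at by (auto simp: dist_real_def)
  have "((\<lambda>r::real. C * \<bar>r\<bar> powr p) \<longlongrightarrow> C * \<bar>0\<bar> powr p) (at 0)"
    using p by (intro tendsto_intros) auto
  hence lim: "((\<lambda>r::real. C * \<bar>r\<bar> powr p) \<longlongrightarrow> 0) (at 0)" using p by simp
  have "(g \<longlongrightarrow> 0) (at 0)"
    by (rule Lim_null_comparison[OF _ lim]) (use C(2) in simp)
  moreover have "(g \<longlongrightarrow> g 0) (at 0)"
    using cont by (simp add: continuous_on_eq_continuous_at isCont_def)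
  ultimately have "g 0 = 0" using tendsto_unique[of "at (0::real)"] by force
  hence "\<bar>g r\<bar> \<le> C * \<bar>r\<bar> powr p" if "\<bar>r\<bar> \<le> d / 2" for r
    using d(2)[of r] d(1) that by (cases "r = 0") auto
  thus ?thesis using that[of C "d / 2"] C(1) d(1) by simp
qed

lemma model_hom:
  assumes "\<alpha> > 1"
  shows "C2 (V_hom \<alpha> km kp)" "deriv (V_hom \<alpha> km kp) 0 = 0" "C2 (\<lambda>_::real. 0::real)" "deriv (\<lambda>_::real. 0::real) 0 = 0"
  using assms C2_V_hom C2_zero by (auto simp: deriv_V_hom force_hom_def pos_powr_def)

text \<open>
  Everything that distinguishes the lattice force from its homogeneous part is again a lattice force,
  with interaction potential \<open>W\<close> and on-site potential \<open>\<phi>\<close>. The estimates for lattice forces therefore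
  apply to the remainder as well.
\<close>

lemma correction_potential:
  assumes \<alpha>: "\<alpha> > 1" and V: "C2 V" "deriv V 0 = 0" and \<phi>: "C2 \<phi>" "deriv \<phi> 0 = 0"
    and VW: "\<And>r. V r = V_hom \<alpha> km kp r + W r" and W0: "deriv W 0 = 0"
  shows "C2 W" and "deriv (deriv V) r = stiffness_hom \<alpha> km kp r + deriv (deriv W) r"
    and "lattice_F V \<phi> x - lattice_F (V_hom \<alpha> km kp) (\<lambda>_. 0) x = lattice_F W \<phi> x"
proof -
  have W: "W = (\<lambda>r. V r - V_hom \<alpha> km kp r)" using VW by auto
  have d1: "(W has_real_derivative deriv V r - force_hom \<alpha> km kp r) (at r)" for r
    unfolding W by (intro DERIV_diff C2_realD(1)[OF V(1)] has_derivative_V_hom[OF \<alpha>])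
  hence W1: "deriv W = (\<lambda>r. deriv V r - force_hom \<alpha> km kp r)" by (intro ext DERIV_imp_deriv)
  have d2: "((\<lambda>r. deriv V r - force_hom \<alpha> km kp r) has_real_derivative
      deriv (deriv V) r - stiffness_hom \<alpha> km kp r) (at r)" for r
    by (intro DERIV_diff C2_realD(2)[OF V(1)] has_derivative_force_hom[OF \<alpha>])
  hence W2: "deriv (deriv W) = (\<lambda>r. deriv (deriv V) r - stiffness_hom \<alpha> km kp r)"
    unfolding W1 by (intro ext DERIV_imp_deriv)
  show "C2 W"
    by (rule C2_realI[OF d1 d2]) (intro continuous_on_diff C2_realD(3)[OF V(1)] continuous_stiffness_hom[OF \<alpha>])
  show "deriv (deriv V) r = stiffness_hom \<alpha> km kp r + deriv (deriv W) r" by (simp add: W2)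
  show "lattice_F V \<phi> x - lattice_F (V_hom \<alpha> km kp) (\<lambda>_. 0) x = lattice_F W \<phi> x"
    by (rule ell2_eqI)
      (simp add: ell2_nth_lattice_F[OF V \<phi>] ell2_nth_lattice_F[OF model_hom[OF \<alpha>]]
        ell2_nth_lattice_F[OF \<open>C2 W\<close> W0 \<phi>] deriv_V_hom[OF \<alpha>] W1)
qed

text \<open>
  A common constant and a common radius for all bounds on second derivatives. On the unit interval a
  larger exponent gives the stronger bound, so the radius is taken to be at most one.
\<close>

lemma model_bounds:
  fixes V W \<phi> :: "real \<Rightarrow> real"
  assumes \<alpha>: "\<alpha> > 1" and pos: "\<beta> > 0" "\<gamma> > 0"
    and V: "C2 V" "deriv V 0 = 0" and \<phi>: "C2 \<phi>" "deriv \<phi> 0 = 0"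
    and VW: "\<And>r. V r = V_hom \<alpha> km kp r + W r" and W0: "deriv W 0 = 0"
    and bW: "deriv (deriv W) \<in> O[at 0](\<lambda>r. \<bar>r\<bar> powr (\<alpha> - 1 + \<beta>))"
    and b\<phi>: "deriv (deriv \<phi>) \<in> O[at 0](\<lambda>x. \<bar>x\<bar> powr (\<alpha> - 1 + \<gamma>))"
  obtains C d where "C > 0" "d > 0"
    "\<And>r. \<bar>r\<bar> \<le> d \<Longrightarrow> \<bar>deriv (deriv V) r\<bar> \<le> C * \<bar>r\<bar> powr (\<alpha> - 1)"
    "\<And>r. \<bar>r\<bar> \<le> d \<Longrightarrow> \<bar>stiffness_hom \<alpha> km kp r\<bar> \<le> C * \<bar>r\<bar> powr (\<alpha> - 1)"
    "\<And>r. \<bar>r\<bar> \<le> d \<Longrightarrow> \<bar>deriv (deriv \<phi>) r\<bar> \<le> C * \<bar>r\<bar> powr (\<alpha> - 1)"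
    "\<And>r. \<bar>r\<bar> \<le> d \<Longrightarrow> \<bar>deriv (deriv W) r\<bar> \<le> C * \<bar>r\<bar> powr (\<alpha> - 1 + min \<beta> \<gamma>)"
    "\<And>r. \<bar>r\<bar> \<le> d \<Longrightarrow> \<bar>deriv (deriv \<phi>) r\<bar> \<le> C * \<bar>r\<bar> powr (\<alpha> - 1 + min \<beta> \<gamma>)"
proof -
  note W = correction_potential[OF \<alpha> V \<phi> VW W0]
  obtain C1 d1 where 1: "C1 > 0" "d1 > 0" "\<And>r. \<bar>r\<bar> \<le> d1 \<Longrightarrow> \<bar>deriv (deriv W) r\<bar> \<le> C1 * \<bar>r\<bar> powr (\<alpha> - 1 + \<beta>)"
    using bigo_powr_imp_bound[OF bW C2_realD(3)[OF W(1)]] \<alpha> pos by auto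
  obtain C2' d2 where 2: "C2' > 0" "d2 > 0" "\<And>r. \<bar>r\<bar> \<le> d2 \<Longrightarrow> \<bar>deriv (deriv \<phi>) r\<bar> \<le> C2' * \<bar>r\<bar> powr (\<alpha> - 1 + \<gamma>)"
    using bigo_powr_imp_bound[OF b\<phi> C2_realD(3)[OF \<phi>(1)]] \<alpha> pos by auto
  define S where "S = \<alpha> * (\<bar>km\<bar> + \<bar>kp\<bar>)"
  define C where "C = S + C1 + C2'"
  define d where "d = min 1 (min d1 d2)"
  have S: "S \<ge> 0" using \<alpha> by (simp add: S_def)
  have C: "C > 0" "S + C1 \<le> C" "C1 \<le> C" "C2' \<le> C" "S \<le> C" using S 1(1) 2(1) by (auto simp: C_def)
  have powr_le: "c * \<bar>r\<bar> powr q \<le> c' * \<bar>r\<bar> powr p"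
    if "\<bar>r\<bar> \<le> d" "p \<le> q" "0 \<le> c" "c \<le> c'" for c c' r p q :: real
  proof (cases "r = 0")
    case False
    thus ?thesis using that by (intro mult_mono powr_mono') (auto simp: d_def)
  qed simp
  show ?thesis
  proof (rule that[of C d])
    show "C > 0" "d > 0" using C 1 2 by (auto simp: d_def)
    fix r assume r: "\<bar>r\<bar> \<le> d"
    hence rr: "\<bar>r\<bar> \<le> d1" "\<bar>r\<bar> \<le> d2" by (auto simp: d_def)
    have st: "\<bar>stiffness_hom \<alpha> km kp r\<bar> \<le> S * \<bar>r\<bar> powr (\<alpha> - 1)"
      using stiffness_hom_bound[OF \<alpha>] by (simp add: S_def)
    have "\<bar>deriv (deriv V) r\<bar> \<le> \<bar>stiffness_hom \<alpha> km kp r\<bar> + \<bar>deriv (deriv W) r\<bar>"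
      unfolding W(2) by (rule abs_triangle_ineq)
    also have "\<dots> \<le> S * \<bar>r\<bar> powr (\<alpha> - 1) + C1 * \<bar>r\<bar> powr (\<alpha> - 1)"
    proof (rule add_mono[OF st order_trans[OF 1(3)[OF rr(1)]]])
      show "C1 * \<bar>r\<bar> powr (\<alpha> - 1 + \<beta>) \<le> C1 * \<bar>r\<bar> powr (\<alpha> - 1)"
        by (rule powr_le[OF r]) (use pos 1 in auto)
    qed
    also have "\<dots> = (S + C1) * \<bar>r\<bar> powr (\<alpha> - 1)" by (rule distrib_right[symmetric])
    also have "\<dots> \<le> C * \<bar>r\<bar> powr (\<alpha> - 1)" by (intro mult_right_mono C) simp
    finally show "\<bar>deriv (deriv V) r\<bar> \<le> C * \<bar>r\<bar> powr (\<alpha> - 1)" .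
    show "\<bar>stiffness_hom \<alpha> km kp r\<bar> \<le> C * \<bar>r\<bar> powr (\<alpha> - 1)"
      using st powr_le[OF r order_refl S C(5)] by (rule order_trans)
    show "\<bar>deriv (deriv \<phi>) r\<bar> \<le> C * \<bar>r\<bar> powr (\<alpha> - 1)"
      using 2(3)[OF rr(2)] by (rule order_trans) (rule powr_le[OF r], use pos 2 C in auto)
    show "\<bar>deriv (deriv W) r\<bar> \<le> C * \<bar>r\<bar> powr (\<alpha> - 1 + min \<beta> \<gamma>)"
      using 1(3)[OF rr(1)] by (rule order_trans) (rule powr_le[OF r], use 1 C in auto)
    show "\<bar>deriv (deriv \<phi>) r\<bar> \<le> C * \<bar>r\<bar> powr (\<alpha> - 1 + min \<beta> \<gamma>)"
      using 2(3)[OF rr(2)] by (rule order_trans) (rule powr_le[OF r], use 2 C in auto)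
  qed
qed

section \<open>The rotating frame\<close>

lemma norm_lattice_J [simp]: "norm (lattice_J X) = norm X"
  by (simp add: lattice_J_def norm_prod_def add.commute)

lemma bounded_linear_lattice_J: "bounded_linear lattice_J"
proof (rule bounded_linear_intro[where K = 1])
  show "norm (lattice_J X) \<le> norm X * 1" for X by simp
qed (simp_all add: lattice_J_def)

text \<open>
  The flow of the linear part \<open>X' = lattice_J X\<close>, a one-parameter group of isometries.
\<close>

definition rot :: "real \<Rightarrow> real ell2 \<times> real ell2 \<Rightarrow> real ell2 \<times> real ell2" where
  "rot t X = cos t *\<^sub>R X + sin t *\<^sub>R lattice_J X"

lemma rot_simps: "fst (rot t X) = cos t *\<^sub>R fst X + sin t *\<^sub>R snd X"
  "snd (rot t X) = cos t *\<^sub>R snd X - sin t *\<^sub>R fst X"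
  by (simp_all add: rot_def lattice_J_def)

lemma rot_zero [simp]: "rot 0 X = X"
  by (simp add: rot_def)

lemma rot_diff: "rot t X - rot t Y = rot t (X - Y)"
  by (simp add: prod_eq_iff rot_simps algebra_simps)

lemma rot_rot: "rot s (rot t X) = rot (s + t) X"
  by (simp add: prod_eq_iff rot_simps cos_add sin_add algebra_simps)

lemma norm_rot [simp]: "norm (rot t X) = norm X"
proof -
  have "inner (rot t X) (rot t X) = inner X X"
  proof -
    have "inner X (lattice_J X) = 0"
      by (simp add: lattice_J_def inner_prod_def inner_commute)
    moreover have "inner (lattice_J X) (lattice_J X) = inner X X"
      by (simp flip: power2_norm_eq_inner)
    ultimately have "inner (rot t X) (rot t X) = (cos t)\<^sup>2 * inner X X + (sin t)\<^sup>2 * inner X X"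
      by (simp add: rot_def inner_add_left inner_add_right inner_commute[of "lattice_J X" X]
          power2_eq_square mult.assoc)
    also have "\<dots> = inner X X" by (simp flip: distrib_right)
    finally show ?thesis .
  qed
  thus ?thesis by (simp add: norm_eq_sqrt_inner)
qed

lemma continuous_on_rot:
  fixes S :: "real set"
  assumes "continuous_on S \<theta>" "continuous_on S X"
  shows "continuous_on S (\<lambda>t. rot (\<theta> t) (X t))"
  unfolding rot_def
  by (intro continuous_intros assms bounded_linear.continuous_on[OF bounded_linear_lattice_J])

lemma has_vector_derivative_rot:
  assumes "(Y has_vector_derivative Y') (at t within S)"
  shows "((\<lambda>t. rot t (Y t)) has_vector_derivative lattice_J (rot t (Y t)) + rot t Y') (at t within S)"
proof -
  have "((\<lambda>t. rot t (Y t)) has_vector_derivative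
      (cos t *\<^sub>R Y' + (- sin t) *\<^sub>R Y t) + (sin t *\<^sub>R lattice_J Y' + cos t *\<^sub>R lattice_J (Y t)))
      (at t within S)"
    unfolding rot_def
    by (intro has_vector_derivative_add has_vector_derivative_scaleR assms
        bounded_linear.has_vector_derivative[OF bounded_linear_lattice_J])
      (auto intro!: derivative_eq_intros)
  moreover have "(cos t *\<^sub>R Y' + (- sin t) *\<^sub>R Y t) + (sin t *\<^sub>R lattice_J Y' + cos t *\<^sub>R lattice_J (Y t))
      = lattice_J (rot t (Y t)) + rot t Y'"
    by (simp add: prod_eq_iff rot_simps lattice_J_def algebra_simps)
  ultimately show ?thesis by simp
qed

text \<open>
  The lattice vector field after the substitution \<open>X = rot t (Y t)\<close>, which removes the linear part.
\<close>

definition rotating_G ::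
  "(real \<Rightarrow> real) \<Rightarrow> (real \<Rightarrow> real) \<Rightarrow> real \<Rightarrow> real ell2 \<times> real ell2 \<Rightarrow> real ell2 \<times> real ell2" where
  "rotating_G V \<phi> t X = rot (- t) (lattice_G V \<phi> (rot t X))"

lemma norm_fst_le_norm: "norm (fst X) \<le> norm X" for X :: "'a::real_normed_vector \<times> 'b::real_normed_vector"
  using norm_fst_le[of "fst X" "snd X"] by simp

lemma rotating_G_lipschitz:
  assumes lip: "\<And>x y. norm x \<le> \<rho> \<Longrightarrow> norm y \<le> \<rho> \<Longrightarrow>
      norm (lattice_F V \<phi> x - lattice_F V \<phi> y) \<le> L * norm (x - y)"
    and L: "L \<ge> 0" and X: "norm X \<le> \<rho>" and Y: "norm Y \<le> \<rho>"
  shows "norm (rotating_G V \<phi> t X - rotating_G V \<phi> t Y) \<le> L * norm (X - Y)"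
proof -
  have "norm (rotating_G V \<phi> t X - rotating_G V \<phi> t Y)
      = norm (lattice_F V \<phi> (fst (rot t X)) - lattice_F V \<phi> (fst (rot t Y)))"
    by (simp add: rotating_G_def rot_diff lattice_G_def)
  also have "\<dots> \<le> L * norm (fst (rot t X) - fst (rot t Y))"
    using X Y norm_fst_le_norm[of "rot t X"] norm_fst_le_norm[of "rot t Y"] by (intro lip) auto
  also have "\<dots> \<le> L * norm (X - Y)"
    using norm_fst_le_norm[of "rot t X - rot t Y"] L by (intro mult_left_mono) (auto simp: rot_diff simp flip: fst_diff)
  finally show ?thesis .
qed

lemma continuous_on_rotating_G:
  assumes V: "C2 V" "deriv V 0 = 0" and \<phi>: "C2 \<phi>" "deriv \<phi> 0 = 0"
    and X: "continuous_on S X"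
  shows "continuous_on S (\<lambda>t. rotating_G V \<phi> t (X t))"
  unfolding rotating_G_def lattice_G_def
  by (intro continuous_on_rot continuous_intros X
      continuous_on_compose2[OF continuous_on_lattice_F[OF V \<phi>, of UNIV]]) auto

section \<open>The averaged vector field\<close>

abbreviation rotating_hom :: "real \<Rightarrow> real \<Rightarrow> real \<Rightarrow> real \<Rightarrow> real ell2 \<times> real ell2 \<Rightarrow> real ell2 \<times> real ell2" where
  "rotating_hom \<alpha> km kp \<equiv> rotating_G (V_hom \<alpha> km kp) (\<lambda>_. 0)"

definition averaged_G :: "real \<Rightarrow> real \<Rightarrow> real \<Rightarrow> real ell2 \<times> real ell2 \<Rightarrow> real ell2 \<times> real ell2" where
  "averaged_G \<alpha> km kp X = (1 / (2*pi)) *\<^sub>R integral {0..2*pi} (\<lambda>s. rotating_hom \<alpha> km kp s X)"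

lemma ell2_nth_rotating_hom:
  fixes km kp :: real and X defines "u \<equiv> delta_minus (fst X)" and "v \<equiv> delta_minus (snd X)"
  assumes \<alpha>: "\<alpha> > 1"
  defines "h \<equiv> \<lambda>s n. force_hom \<alpha> km kp (cos s * ell2_nth u n + sin s * ell2_nth v n)"
  shows "ell2_nth (fst (rotating_hom \<alpha> km kp s X)) n = h s n * sin s - h s (n + 1) * sin s"
    and "ell2_nth (snd (rotating_hom \<alpha> km kp s X)) n = h s (n + 1) * cos s - h s n * cos s"
  by (simp_all add: rotating_G_def rot_simps lattice_G_def ell2_nth_lattice_F[OF model_hom[OF \<alpha>]]
      deriv_V_hom[OF \<alpha>] h_def u_def v_def algebra_simps)

text \<open>
  Coordinate evaluations are bounded linear, so they commute with the integral, and each coordinate of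
  the integrand is a difference of the scalar integrands treated above at two neighbouring bonds.
\<close>

lemma integral_rotating_hom:
  fixes km kp :: real and X defines "u \<equiv> delta_minus (fst X)" and "v \<equiv> delta_minus (snd X)"
  assumes \<alpha>: "\<alpha> > 1"
  defines "w \<equiv> \<lambda>n. sqrt ((ell2_nth u n)\<^sup>2 + (ell2_nth v n)\<^sup>2) powr (\<alpha> - 1)"
  defines "Q \<equiv> (km + kp) * Beta (1/2) (\<alpha> / 2 + 1)"
  defines "I \<equiv> \<lambda>a. integral {a..a + 2*pi} (\<lambda>s. rotating_hom \<alpha> km kp s X)"
  shows "ell2_nth (fst (I a)) n = Q * (w n * ell2_nth v n) - Q * (w (n + 1) * ell2_nth v (n + 1))"
    and "ell2_nth (snd (I a)) n = Q * (w (n + 1) * ell2_nth u (n + 1)) - Q * (w n * ell2_nth u n)"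
proof -
  define h where "h = (\<lambda>s n. force_hom \<alpha> km kp (cos s * ell2_nth u n + sin s * ell2_nth v n))"
  have int: "(\<lambda>s. rotating_hom \<alpha> km kp s X) integrable_on {a..a + 2*pi}"
    by (intro integrable_continuous_real continuous_on_rotating_G[OF model_hom[OF \<alpha>]] continuous_on_const)
  have conth: "continuous_on S (\<lambda>s. h s k)" for S k
    unfolding h_def force_hom_def using \<alpha> by (intro continuous_intros) auto
  have inth: "(\<lambda>s. h s k * sin s) integrable_on {a..a + 2*pi}"
    "(\<lambda>s. h s k * cos s) integrable_on {a..a + 2*pi}" for k
    by (intro integrable_continuous_real continuous_intros conth)+
  have Ih: "integral {a..a + 2*pi} (\<lambda>s. h s k * sin s) = Q * (w k * ell2_nth v k)"
    "integral {a..a + 2*pi} (\<lambda>s. h s k * cos s) = Q * (w k * ell2_nth u k)" for k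
    using integral_force_hom[OF \<alpha>] by (simp_all add: h_def Q_def w_def)
  have "ell2_nth (fst (I a)) n = integral {a..a + 2*pi} ((\<lambda>X. ell2_nth (fst X) n) \<circ> (\<lambda>s. rotating_hom \<alpha> km kp s X))"
    unfolding I_def
    by (intro integral_linear[symmetric] int bounded_linear_compose[OF bounded_linear_ell2_nth bounded_linear_fst])
  also have "\<dots> = integral {a..a + 2*pi} (\<lambda>s. h s n * sin s - h s (n + 1) * sin s)"
    using ell2_nth_rotating_hom(1)[OF \<alpha>, where X = X] by (simp add: o_def h_def u_def v_def)
  also have "\<dots> = Q * (w n * ell2_nth v n) - Q * (w (n + 1) * ell2_nth v (n + 1))"
    by (simp only: Henstock_Kurzweil_Integration.integral_diff inth Ih)
  finally show "ell2_nth (fst (I a)) n = Q * (w n * ell2_nth v n) - Q * (w (n + 1) * ell2_nth v (n + 1))" .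
  have "ell2_nth (snd (I a)) n = integral {a..a + 2*pi} ((\<lambda>X. ell2_nth (snd X) n) \<circ> (\<lambda>s. rotating_hom \<alpha> km kp s X))"
    unfolding I_def
    by (intro integral_linear[symmetric] int bounded_linear_compose[OF bounded_linear_ell2_nth bounded_linear_snd])
  also have "\<dots> = integral {a..a + 2*pi} (\<lambda>s. h s (n + 1) * cos s - h s n * cos s)"
    using ell2_nth_rotating_hom(2)[OF \<alpha>, where X = X] by (simp add: o_def h_def u_def v_def)
  also have "\<dots> = Q * (w (n + 1) * ell2_nth u (n + 1)) - Q * (w n * ell2_nth u n)"
    by (simp only: Henstock_Kurzweil_Integration.integral_diff inth Ih)
  finally show "ell2_nth (snd (I a)) n = Q * (w (n + 1) * ell2_nth u (n + 1)) - Q * (w n * ell2_nth u n)" .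
qed

lemma integral_rotating_hom_averaged:
  assumes "\<alpha> > 1"
  shows "integral {a..a + 2*pi} (\<lambda>s. rotating_hom \<alpha> km kp s X) = (2*pi) *\<^sub>R averaged_G \<alpha> km kp X"
proof -
  have "integral {a..a + 2*pi} (\<lambda>s. rotating_hom \<alpha> km kp s X)
      = integral {0..0 + 2*pi} (\<lambda>s. rotating_hom \<alpha> km kp s X)"
    by (auto simp only: prod_eq_iff integral_rotating_hom[OF assms] intro!: ell2_eqI)
  thus ?thesis by (simp add: averaged_G_def)
qed

lemma averaged_G_lipschitz:
  assumes \<alpha>: "\<alpha> > 1"
    and lip: "\<And>x y. norm x \<le> \<rho> \<Longrightarrow> norm y \<le> \<rho> \<Longrightarrow>
      norm (lattice_F (V_hom \<alpha> km kp) (\<lambda>_. 0) x - lattice_F (V_hom \<alpha> km kp) (\<lambda>_. 0) y) \<le> L * norm (x - y)"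
    and L: "L \<ge> 0" and X: "norm X \<le> \<rho>" and Y: "norm Y \<le> \<rho>"
  shows "norm (averaged_G \<alpha> km kp X - averaged_G \<alpha> km kp Y) \<le> L * norm (X - Y)"
proof -
  have cont: "continuous_on {0..2*pi} (\<lambda>s. rotating_hom \<alpha> km kp s Z)" for Z
    by (intro continuous_on_rotating_G[OF model_hom[OF \<alpha>]] continuous_on_const)
  have eq: "averaged_G \<alpha> km kp X - averaged_G \<alpha> km kp Y
      = (1 / (2*pi)) *\<^sub>R integral {0..2*pi} (\<lambda>s. rotating_hom \<alpha> km kp s X - rotating_hom \<alpha> km kp s Y)"
    unfolding averaged_G_def
    by (subst Henstock_Kurzweil_Integration.integral_diff)
      (auto intro!: integrable_continuous_real cont simp: scaleR_diff_right)
  have "norm (averaged_G \<alpha> km kp X - averaged_G \<alpha> km kp Y) = (1 / (2*pi)) * norm (integral {0..2*pi}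
      (\<lambda>s. rotating_hom \<alpha> km kp s X - rotating_hom \<alpha> km kp s Y))"
    unfolding eq by simp
  also have "\<dots> \<le> (1 / (2*pi)) * (L * norm (X - Y) * (2*pi - 0))"
  proof (rule mult_left_mono)
    have "norm (rotating_hom \<alpha> km kp s X - rotating_hom \<alpha> km kp s Y) \<le> L * norm (X - Y)" for s
      by (rule rotating_G_lipschitz[OF _ L X Y]) (rule lip)
    thus "norm (integral {0..2*pi} (\<lambda>s. rotating_hom \<alpha> km kp s X - rotating_hom \<alpha> km kp s Y))
        \<le> L * norm (X - Y) * (2*pi - 0)"
      by (intro integral_bound continuous_on_diff cont) simp_all
  qed simp
  finally show ?thesis by simp
qed

lemma rotating_G_zero:
  assumes "C2 V" "deriv V 0 = 0" "C2 \<phi>" "deriv \<phi> 0 = 0"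
  shows "rotating_G V \<phi> t 0 = 0"
  using lattice_F_zero[OF assms] by (simp add: rotating_G_def lattice_G_def rot_def lattice_J_def prod_eq_iff)

lemma averaged_G_zero: "\<alpha> > 1 \<Longrightarrow> averaged_G \<alpha> km kp 0 = 0"
  by (simp add: averaged_G_def rotating_G_zero[OF model_hom])

section \<open>The amplitude equation as the averaged equation\<close>

lemma ell2_nth_plus_cc_Re: "ell2_nth (plus_cc a) n = 2 * Re (ell2_nth a n)"
proof -
  have "Re (complex_of_real (ell2_nth (plus_cc a) n)) = Re (ell2_nth a n + cnj (ell2_nth a n))"
    by (simp only: ell2_nth_plus_cc)
  thus ?thesis by simp
qed

text \<open>
  Real coordinates of a complex amplitude: the pair with components \<open>sqrt 2 * Re a\<close> and
  \<open>- sqrt 2 * Im a\<close>, that is, \<open>X_approx\<close> at phase zero.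
\<close>

definition demod :: "complex ell2 \<Rightarrow> real ell2 \<times> real ell2" where
  "demod a = (plus_cc (cscale (complex_of_real (1 / sqrt 2)) a),
              plus_cc (cscale (\<i> * complex_of_real (1 / sqrt 2)) a))"

lemma ell2_nth_demod:
  "ell2_nth (fst (demod a)) n = sqrt 2 * Re (ell2_nth a n)"
  "ell2_nth (snd (demod a)) n = - sqrt 2 * Im (ell2_nth a n)"
  by (simp_all add: demod_def ell2_nth_plus_cc_Re ell2_nth_cscale real_divide_square_eq
      real_div_sqrt flip: times_divide_eq_left)

lemma norm_demod: "norm (demod a) = sqrt 2 * norm a"
proof -
  have "(norm (demod a))\<^sup>2 = (norm (fst (demod a)))\<^sup>2 + (norm (snd (demod a)))\<^sup>2"
    by (simp add: norm_prod_def)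
  also have "\<dots> = (\<Sum>\<^sub>\<infinity>n. (norm (ell2_nth (fst (demod a)) n))\<^sup>2 + (norm (ell2_nth (snd (demod a)) n))\<^sup>2)"
    unfolding norm_ell2_power2 by (rule infsum_add[OF summable_ell2 summable_ell2, symmetric])
  also have "\<dots> = (\<Sum>\<^sub>\<infinity>n. 2 * (norm (ell2_nth a n))\<^sup>2)"
    by (intro infsum_cong) (simp add: ell2_nth_demod cmod_power2 power_mult_distrib algebra_simps)
  also have "\<dots> = (sqrt 2 * norm a)\<^sup>2"
    by (simp add: infsum_cmult_right' norm_ell2_power2 power_mult_distrib)
  finally show ?thesis by (simp add: power2_eq_iff_nonneg)
qed

lemma bounded_linear_demod: "bounded_linear demod"
proof (rule bounded_linear_intro[where K = "sqrt 2"])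
  show "demod (x + y) = demod x + demod y" for x y
    by (auto simp: prod_eq_iff ell2_nth_demod algebra_simps intro!: ell2_eqI)
  show "demod (r *\<^sub>R x) = r *\<^sub>R demod x" for r x
    by (auto simp: prod_eq_iff ell2_nth_demod algebra_simps intro!: ell2_eqI)
  show "norm (demod x) \<le> norm x * sqrt 2" for x by (simp add: norm_demod)
qed

lemma X_approx_eq_rot: "X_approx A t = rot t (demod (A t))"
proof -
  have c: "2 / sqrt 2 = sqrt (2::real)" by (simp add: real_div_sqrt)
  have "ell2_nth (fst (X_approx A t)) n
      = 2 / sqrt 2 * (cos t * Re (ell2_nth (A t) n) - sin t * Im (ell2_nth (A t) n))" for n
    by (simp add: X_approx_def Let_def ell2_nth_plus_cc_Re ell2_nth_cscale cis_conv_exp[symmetric]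
        field_simps)
  moreover have "ell2_nth (snd (X_approx A t)) n
      = - (2 / sqrt 2) * (cos t * Im (ell2_nth (A t) n) + sin t * Re (ell2_nth (A t) n))" for n
    by (simp add: X_approx_def Let_def ell2_nth_plus_cc_Re ell2_nth_cscale cis_conv_exp[symmetric]
        field_simps)
  ultimately show ?thesis
    unfolding c
    by (auto simp: prod_eq_iff rot_simps ell2_nth_demod algebra_simps intro!: ell2_eqI)
qed

lemma amplitude_derivative:
  assumes sol: "amplitude_solution \<alpha> km kp A" and \<alpha>: "\<alpha> > 1"
  obtains A' where "\<And>t. (A has_vector_derivative A' t) (at t)"
    "\<And>t. cscale \<i> (A' t) = delta_plus (amplitude_f \<alpha> km kp (delta_minus (A t)))"
proof -
  obtain A' where A': "\<And>t. (A has_vector_derivative A' t) (at t)"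
    using sol by (auto simp: amplitude_solution_def C2_def)
  hence "vector_derivative A (at t) = A' t" for t by (intro vector_derivative_at)
  with A' show ?thesis using sol that unfolding amplitude_solution_def by auto
qed

text \<open>
  The averaging principle for this lattice: in real coordinates the amplitude equation is the averaged
  equation, with the right constant \<open>omega0\<close>.
\<close>

lemma demod_amplitude_derivative:
  assumes \<alpha>: "\<alpha> > 1" and a': "cscale \<i> a' = delta_plus (amplitude_f \<alpha> km kp (delta_minus a))"
  shows "demod a' = averaged_G \<alpha> km kp (demod a)"
proof -
  define d where "d = delta_minus a"
  define w where "w = (\<lambda>n. sqrt ((ell2_nth (delta_minus (fst (demod a))) n)\<^sup>2
    + (ell2_nth (delta_minus (snd (demod a))) n)\<^sup>2) powr (\<alpha> - 1))"
  define Q where "Q = (km + kp) * Beta (1/2) (\<alpha> / 2 + 1)"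
  have u: "ell2_nth (delta_minus (fst (demod a))) n = sqrt 2 * Re (ell2_nth d n)"
    and v: "ell2_nth (delta_minus (snd (demod a))) n = - (sqrt 2 * Im (ell2_nth d n))" for n
    by (simp_all add: ell2_nth_demod d_def algebra_simps)
  have w: "w n = 2 powr ((\<alpha> - 1) / 2) * cmod (ell2_nth d n) powr (\<alpha> - 1)" for n
  proof -
    have "sqrt ((sqrt 2 * Re (ell2_nth d n))\<^sup>2 + (- (sqrt 2 * Im (ell2_nth d n)))\<^sup>2)
        = sqrt 2 * cmod (ell2_nth d n)"
    proof -
      have "(sqrt 2 * Re (ell2_nth d n))\<^sup>2 + (- (sqrt 2 * Im (ell2_nth d n)))\<^sup>2
          = 2 * ((Re (ell2_nth d n))\<^sup>2 + (Im (ell2_nth d n))\<^sup>2)"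
        by (simp add: power_mult_distrib)
      thus ?thesis by (simp only: real_sqrt_mult cmod_def)
    qed
    hence "w n = (sqrt 2 * cmod (ell2_nth d n)) powr (\<alpha> - 1)" by (simp only: w_def u v)
    also have "\<dots> = (2 powr (1/2)) powr (\<alpha> - 1) * cmod (ell2_nth d n) powr (\<alpha> - 1)"
      by (simp add: powr_mult powr_half_sqrt)
    finally show ?thesis by (simp add: powr_powr)
  qed
  have Qw: "Q / (2*pi) * w n = omega0 \<alpha> km kp * cmod (ell2_nth d n) powr (\<alpha> - 1)" for n
    unfolding w omega0_conv_Beta[OF \<alpha>] Q_def by simp
  have a'n: "\<i> * ell2_nth a' n = of_real (Q / (2*pi) * w (n + 1)) * ell2_nth d (n + 1)
      - of_real (Q / (2*pi) * w n) * ell2_nth d n" for n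
    unfolding Qw using arg_cong[OF a', of "\<lambda>x. ell2_nth x n"]
    by (simp add: ell2_nth_cscale ell2_nth_amplitude_f[OF \<alpha>] mult_ac flip: d_def)
  have re: "Re (ell2_nth a' n) = Q / (2*pi) * w (n + 1) * Im (ell2_nth d (n + 1)) - Q / (2*pi) * w n * Im (ell2_nth d n)"
    and im: "- Im (ell2_nth a' n) = Q / (2*pi) * w (n + 1) * Re (ell2_nth d (n + 1)) - Q / (2*pi) * w n * Re (ell2_nth d n)" for n
    using arg_cong[OF a'n[of n], of Im] arg_cong[OF a'n[of n], of Re]
    by (simp_all del: of_real_divide of_real_mult)
  note I = integral_rotating_hom[OF \<alpha>, where a = 0 and X = "demod a", simplified add_0]
  have fold: "sqrt ((ell2_nth (delta_minus (fst (demod a))) n)\<^sup>2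
    + (ell2_nth (delta_minus (snd (demod a))) n)\<^sup>2) powr (\<alpha> - 1) = w n" for n
    by (simp only: w_def)
  have 1: "ell2_nth (fst (demod a')) n = ell2_nth (fst (averaged_G \<alpha> km kp (demod a))) n" for n
  proof -
    have "ell2_nth (fst (averaged_G \<alpha> km kp (demod a))) n
        = 1 / (2*pi) * (Q * (w n * (- (sqrt 2 * Im (ell2_nth d n))))
            - Q * (w (n + 1) * (- (sqrt 2 * Im (ell2_nth d (n + 1))))))"
      unfolding averaged_G_def fst_scaleR ell2_nth_simps(5) I(1)
      unfolding fold Q_def[symmetric] unfolding v by simp
    thus ?thesis unfolding ell2_nth_demod re by (simp add: algebra_simps)
  qed
  have 2: "ell2_nth (snd (demod a')) n = ell2_nth (snd (averaged_G \<alpha> km kp (demod a))) n" for n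
  proof -
    have "ell2_nth (snd (averaged_G \<alpha> km kp (demod a))) n
        = 1 / (2*pi) * (Q * (w (n + 1) * (sqrt 2 * Re (ell2_nth d (n + 1))))
            - Q * (w n * (sqrt 2 * Re (ell2_nth d n))))"
      unfolding averaged_G_def snd_scaleR ell2_nth_simps(5) I(2)
      unfolding fold Q_def[symmetric] unfolding u by simp
    moreover have "ell2_nth (snd (demod a')) n = sqrt 2 * (- Im (ell2_nth a' n))"
      by (simp add: ell2_nth_demod)
    ultimately show ?thesis unfolding im by (simp add: algebra_simps)
  qed
  show ?thesis using 1 2 by (auto simp: prod_eq_iff intro!: ell2_eqI)
qed

text \<open>
  Summation by parts turns \<open>inner A A'\<close> into a sum over the bonds of inner products of \<open>d\<close> with a real
  multiple of \<open>\<i> * d\<close>, and each of them is zero.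
\<close>

lemma amplitude_norm_conserved:
  assumes sol: "amplitude_solution \<alpha> km kp A" and \<alpha>: "\<alpha> > 1"
  shows "norm (A t) = norm (A 0)"
proof -
  obtain A' where A': "\<And>t. (A has_vector_derivative A' t) (at t)"
    "\<And>t. cscale \<i> (A' t) = delta_plus (amplitude_f \<alpha> km kp (delta_minus (A t)))"
    using amplitude_derivative[OF sol \<alpha>] by blast
  have orth: "inner (A t) (A' t) = 0" for t
  proof -
    let ?d = "delta_minus (A t)"
    let ?g = "cscale (- \<i>) (amplitude_f \<alpha> km kp ?d)"
    have "A' t = delta_plus ?g"
    proof (rule ell2_eqI)
      fix n
      have "\<i> * ell2_nth (A' t) n = \<i> * ell2_nth (delta_plus ?g) n"
        using arg_cong[OF A'(2)[of t], of "\<lambda>x. ell2_nth x n"]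
        by (simp add: ell2_nth_cscale algebra_simps)
      thus "ell2_nth (A' t) n = ell2_nth (delta_plus ?g) n" by simp
    qed
    hence "inner (A t) (A' t) = - inner ?d ?g" by (simp add: inner_delta_plus)
    also have "inner ?d ?g = (\<Sum>\<^sub>\<infinity>n::int. 0::real)"
      unfolding inner_ell2_def
      by (intro infsum_cong)
        (simp add: ell2_nth_cscale ell2_nth_amplitude_f[OF \<alpha>] inner_complex_def algebra_simps del: ell2_nth_simps)
    finally show ?thesis by simp
  qed
  have "((\<lambda>t. inner (A t) (A t)) has_real_derivative 0) (at t)" for t
  proof -
    have "((\<lambda>t. inner (A t) (A t)) has_derivative (\<lambda>h. inner (A t) (h *\<^sub>R A' t) + inner (h *\<^sub>R A' t) (A t))) (at t)"
      using A'(1)[of t] by (intro has_derivative_inner) (auto simp: has_vector_derivative_def)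
    moreover have "(\<lambda>h. inner (A t) (h *\<^sub>R A' t) + inner (h *\<^sub>R A' t) (A t)) = (*) 0"
      by (simp add: inner_commute[of "A' t"] orth fun_eq_iff)
    ultimately show ?thesis by (simp only: has_field_derivative_def)
  qed
  hence "inner (A t) (A t) = inner (A 0) (A 0)" by (rule DERIV_isconst_all[rule_format])
  thus ?thesis by (simp add: norm_eq_sqrt_inner)
qed

section \<open>Shadowing of averaged solutions\<close>

text \<open>
  The constant \<open>4 * pi\<close> collects a period \<open>2 * pi\<close> and a factor two, because subtracting the mean doubles
  both the size and the Lipschitz constant of the homogeneous field. The retraction contributes the
  factor two in the exponent. The smallness of \<open>err\<close> confines the solution to the ball of radius \<open>2 * \<epsilon>\<close>,
  where the modified and the original vector fields agree.
\<close>

lemma lattice_shadows_averaged: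
  fixes X0 :: "real ell2 \<times> real ell2"
  assumes \<alpha>: "\<alpha> > 1" and V: "C2 V" "deriv V 0 = 0" and \<phi>: "C2 \<phi>" "deriv \<phi> 0 = 0"
    and \<epsilon>: "\<epsilon> \<ge> 0" and T: "T \<ge> 0" and L: "L \<ge> 0" and D: "D \<ge> 0"
    and lipV: "\<And>x y. norm x \<le> 2 * \<epsilon> \<Longrightarrow> norm y \<le> 2 * \<epsilon> \<Longrightarrow>
      norm (lattice_F V \<phi> x - lattice_F V \<phi> y) \<le> L * norm (x - y)"
    and lipH: "\<And>x y. norm x \<le> \<epsilon> \<Longrightarrow> norm y \<le> \<epsilon> \<Longrightarrow>
      norm (lattice_F (V_hom \<alpha> km kp) (\<lambda>_. 0) x - lattice_F (V_hom \<alpha> km kp) (\<lambda>_. 0) y) \<le> L * norm (x - y)"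
    and rem: "\<And>x. norm x \<le> \<epsilon> \<Longrightarrow> norm (lattice_F V \<phi> x - lattice_F (V_hom \<alpha> km kp) (\<lambda>_. 0) x) \<le> D"
    and P: "\<And>t. t \<in> {0..T} \<Longrightarrow> (P has_vector_derivative averaged_G \<alpha> km kp (P t)) (at t within {0..T})"
    and normP: "\<And>t. t \<in> {0..T} \<Longrightarrow> norm (P t) \<le> \<epsilon>"
  defines "err \<equiv> (norm (X0 - P 0) + (4*pi * L * \<epsilon> + 4*pi * L\<^sup>2 * \<epsilon> * T + D * T)) * exp (2 * L * T)"
  assumes small: "err \<le> \<epsilon>"
  obtains X where "lattice_solution V \<phi> T X0 X" "\<And>t. t \<in> {0..T} \<Longrightarrow> norm (X t - rot t (P t)) \<le> err"
proof -
  define F where "F = (\<lambda>t X. rotating_G V \<phi> t (cap_norm (2 * \<epsilon>) X))"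
  have cap: "norm (cap_norm (2 * \<epsilon>) X) \<le> 2 * \<epsilon>" for X :: "real ell2 \<times> real ell2"
    using \<epsilon> by (intro norm_cap_norm) auto
  have lipF: "norm (F t X - F t Y) \<le> (2 * L) * norm (X - Y)" for t X Y
  proof -
    have "norm (F t X - F t Y) \<le> L * norm (cap_norm (2 * \<epsilon>) X - cap_norm (2 * \<epsilon>) Y)"
      unfolding F_def by (rule rotating_G_lipschitz[OF lipV L cap cap])
    also have "\<dots> \<le> L * (2 * norm (X - Y))"
      using \<epsilon> L by (intro mult_left_mono cap_norm_lipschitz) auto
    finally show ?thesis by simp
  qed
  have cont_cap: "continuous_on S (cap_norm (2 * \<epsilon>) :: real ell2 \<times> real ell2 \<Rightarrow> _)" for S
    by (rule continuous_on_norm_lipschitz[OF _ cap_norm_lipschitz]) (use \<epsilon> in auto)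
  have contF: "continuous_on {0..T} (\<lambda>t. F t (u t))" if "continuous_on {0..T} u" for u
    unfolding F_def
    by (intro continuous_on_rotating_G[OF V \<phi>] continuous_on_compose2[OF cont_cap that]) auto
  obtain Y where Y: "Y 0 = X0"
    "\<And>t. t \<in> {0..T} \<Longrightarrow> (Y has_vector_derivative F t (Y t)) (at t within {0..T})"
    using global_lipschitz_ivp[OF T contF lipF] by blast
  have contP: "continuous_on {0..T} P" using P by (rule continuous_on_vector_derivative)

  \<comment> \<open>\<open>R\<close> is the defect of \<open>P\<close>; it differs from its oscillating part \<open>N\<close> by the remainder of size \<open>D\<close>.\<close>
  define N where "N = (\<lambda>t X. rotating_hom \<alpha> km kp t X - averaged_G \<alpha> km kp X)"
  define R where "R = (\<lambda>t. F t (P t) - averaged_G \<alpha> km kp (P t))"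
  have lip_rot: "norm (rotating_hom \<alpha> km kp t X - rotating_hom \<alpha> km kp t Y) \<le> L * norm (X - Y)"
    and lip_avg: "norm (averaged_G \<alpha> km kp X - averaged_G \<alpha> km kp Y) \<le> L * norm (X - Y)"
    if "norm X \<le> \<epsilon>" "norm Y \<le> \<epsilon>" for t X Y
    by (rule rotating_G_lipschitz[OF lipH L that], assumption+)
      (rule averaged_G_lipschitz[OF \<alpha> lipH L that], assumption+)
  have bound_rot: "norm (rotating_hom \<alpha> km kp t X) \<le> L * \<epsilon>" and bound_avg: "norm (averaged_G \<alpha> km kp X) \<le> L * \<epsilon>"
    if "norm X \<le> \<epsilon>" for t X
    using lip_rot[where X = X and Y = 0 and t = t] lip_avg[where X = X and Y = 0] that \<epsilon> mult_left_mono[OF that L]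
    by (simp_all add: rotating_G_zero[OF model_hom[OF \<alpha>]] averaged_G_zero[OF \<alpha>])
  have cont_avg: "continuous_on (cball 0 \<epsilon>) (averaged_G \<alpha> km kp)"
    by (rule continuous_on_norm_lipschitz[OF L lip_avg]) auto
  have cont_avgP: "continuous_on {0..T} (\<lambda>t. averaged_G \<alpha> km kp (P t))"
    using normP by (intro continuous_on_compose2[OF cont_avg contP]) auto
  have slow: "norm (P s - P t) \<le> L * \<epsilon> * \<bar>s - t\<bar>" if "s \<in> {0..T}" "t \<in> {0..T}" for s t
  proof -
    have "norm (P s - P t) \<le> (L * \<epsilon>) * norm (s - t)"
    proof (rule differentiable_bound[where S = "{0..T}" and f' = "\<lambda>t h. h *\<^sub>R averaged_G \<alpha> km kp (P t)"])
      fix t assume t: "t \<in> {0..T}"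
      show "(P has_derivative (\<lambda>h. h *\<^sub>R averaged_G \<alpha> km kp (P t))) (at t within {0..T})"
        using P[OF t] by (simp add: has_vector_derivative_def)
      show "onorm (\<lambda>h. h *\<^sub>R averaged_G \<alpha> km kp (P t)) \<le> L * \<epsilon>"
        using mult_left_mono[OF bound_avg[OF normP[OF t]], of "\<bar>h\<bar>" for h] L \<epsilon>
        by (intro onorm_bound) (auto simp: mult_ac)
    qed (use that in auto)
    thus ?thesis by simp
  qed
  have contR: "continuous_on {0..T} R"
    unfolding R_def by (intro continuous_on_diff contF contP cont_avgP)
  have contN: "continuous_on {0..T} (\<lambda>t. N t (P t))"
    unfolding N_def by (intro continuous_on_diff continuous_on_rotating_G[OF model_hom[OF \<alpha>]] contP cont_avgP)
  have N_small: "norm (integral {0..t} (\<lambda>s. N s (P s))) \<le> (2*pi) * (2 * L * \<epsilon>) + t * (2 * L * (L * \<epsilon>) * (2*pi))"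
    if "t \<in> {0..T}" for t
  proof (rule averaged_integral_bound[where r = \<epsilon> and P = P, OF _ _ _ _ _ _ _ _ normP slow that])
    fix s X Y
    assume X: "norm (X :: real ell2 \<times> real ell2) \<le> \<epsilon>" and Y: "norm (Y :: real ell2 \<times> real ell2) \<le> \<epsilon>"
    have "N s X - N s Y = (rotating_hom \<alpha> km kp s X - rotating_hom \<alpha> km kp s Y)
        - (averaged_G \<alpha> km kp X - averaged_G \<alpha> km kp Y)"
      by (simp add: N_def)
    thus "norm (N s X - N s Y) \<le> 2 * L * norm (X - Y)"
      using lip_rot[OF X Y, of s] lip_avg[OF X Y]
        norm_triangle_ineq4[of "rotating_hom \<alpha> km kp s X - rotating_hom \<alpha> km kp s Y"
          "averaged_G \<alpha> km kp X - averaged_G \<alpha> km kp Y"]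
      by simp
  next
    fix s X assume X: "norm (X :: real ell2 \<times> real ell2) \<le> \<epsilon>"
    show "norm (N s X) \<le> 2 * L * \<epsilon>"
      using bound_rot[OF X, of s] bound_avg[OF X]
        norm_triangle_ineq4[of "rotating_hom \<alpha> km kp s X" "averaged_G \<alpha> km kp X"]
      by (simp add: N_def)
    have "(\<lambda>t. rotating_hom \<alpha> km kp t X) integrable_on {s..s + 2*pi}"
      by (intro integrable_continuous_real continuous_on_rotating_G[OF model_hom[OF \<alpha>]] continuous_on_const)
    thus "integral {s..s + 2*pi} (\<lambda>t. N t X) = 0"
      unfolding N_def
      by (subst Henstock_Kurzweil_Integration.integral_diff)
        (auto simp: integral_rotating_hom_averaged[OF \<alpha>])
  next
    fix u :: "real \<Rightarrow> real ell2 \<times> real ell2"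
    assume u: "continuous_on {0..T} u" "\<And>t. t \<in> {0..T} \<Longrightarrow> norm (u t) \<le> \<epsilon>"
    show "continuous_on {0..T} (\<lambda>t. N t (u t))"
      unfolding N_def
      by (intro continuous_on_diff continuous_on_rotating_G[OF model_hom[OF \<alpha>]]
          continuous_on_compose2[OF cont_avg] u) (use u(2) in auto)
  qed (use L \<epsilon> in auto)
  have R_split: "norm (R t - N t (P t)) \<le> D" if t: "t \<in> {0..T}" for t
  proof -
    have "R t - N t (P t) = rotating_G V \<phi> t (P t) - rotating_hom \<alpha> km kp t (P t)"
      using normP[OF t] \<epsilon> by (simp add: R_def N_def F_def cap_norm_id)
    also have "norm \<dots> = norm (lattice_F V \<phi> (fst (rot t (P t))) - lattice_F (V_hom \<alpha> km kp) (\<lambda>_. 0) (fst (rot t (P t))))"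
      by (simp add: rotating_G_def rot_diff lattice_G_def)
    also have "\<dots> \<le> D"
      using normP[OF t] norm_fst_le_norm[of "rot t (P t)"] by (intro rem) auto
    finally show ?thesis .
  qed
  have R_small: "norm (integral {0..t} R) \<le> 4*pi * L * \<epsilon> + 4*pi * L\<^sup>2 * \<epsilon> * T + D * T"
    if t: "t \<in> {0..T}" for t
  proof -
    have sub: "{0..t} \<subseteq> {0..T}" using t by auto
    have "norm (integral {0..t} (\<lambda>s. R s - N s (P s))) \<le> D * (t - 0)"
      using t by (intro integral_bound continuous_on_diff continuous_on_subset[OF contR sub]
          continuous_on_subset[OF contN sub] R_split) auto
    also have "\<dots> \<le> D * T" using t D by (intro mult_left_mono) auto
    finally have 1: "norm (integral {0..t} (\<lambda>s. R s - N s (P s))) \<le> D * T" .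
    have "t * (2 * L * (L * \<epsilon>) * (2*pi)) \<le> T * (2 * L * (L * \<epsilon>) * (2*pi))"
      using t L \<epsilon> by (intro mult_right_mono) auto
    hence 2: "norm (integral {0..t} (\<lambda>s. N s (P s))) \<le> 4*pi * L * \<epsilon> + 4*pi * L\<^sup>2 * \<epsilon> * T"
      using N_small[OF t] by (simp add: power2_eq_square mult_ac)
    have "integral {0..t} R = integral {0..t} (\<lambda>s. (R s - N s (P s)) + N s (P s))" by simp
    also have "\<dots> = integral {0..t} (\<lambda>s. R s - N s (P s)) + integral {0..t} (\<lambda>s. N s (P s))"
      by (intro Henstock_Kurzweil_Integration.integral_add integrable_continuous_real continuous_on_diff
          continuous_on_subset[OF contR sub] continuous_on_subset[OF contN sub])
    finally have eq: "integral {0..t} R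
      = integral {0..t} (\<lambda>s. R s - N s (P s)) + integral {0..t} (\<lambda>s. N s (P s))" .
    show ?thesis
      unfolding eq using 1 2 norm_triangle_ineq[of "integral {0..t} (\<lambda>s. R s - N s (P s))" "integral {0..t} (\<lambda>s. N s (P s))"]
      by linarith
  qed
  have est: "norm (Y t - P t) \<le> err" if t: "t \<in> {0..T}" for t
  proof -
    have "norm (Y t - P t) \<le> (norm (Y 0 - P 0) + (4*pi * L * \<epsilon> + 4*pi * L\<^sup>2 * \<epsilon> * T + D * T)) * exp (2 * L * t)"
    proof (rule perturbed_flow_estimate[OF _ contF lipF Y(2) _ contR R_small t])
      show "(P has_vector_derivative F t (P t) - R t) (at t within {0..T})" if "t \<in> {0..T}" for t
        using P[OF that] by (simp add: R_def)
    qed (use L in auto)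
    also have "\<dots> \<le> err"
      unfolding err_def Y(1) using t L \<epsilon> D T by (intro mult_left_mono add_nonneg_nonneg) (auto intro!: mult_left_mono)
    finally show ?thesis .
  qed
  show ?thesis
  proof (rule that[of "\<lambda>t. rot t (Y t)"])
    show "norm (rot t (Y t) - rot t (P t)) \<le> err" if "t \<in> {0..T}" for t
      using est[OF that] by (simp add: rot_diff)
    have "((\<lambda>t. rot t (Y t)) has_vector_derivative lattice_J (rot t (Y t)) + lattice_G V \<phi> (rot t (Y t)))
        (at t within {0..T})" if t: "t \<in> {0..T}" for t
    proof -
      have "norm (Y t) \<le> 2 * \<epsilon>"
        using est[OF t] small normP[OF t] norm_triangle_sub[of "Y t" "P t"] by linarith
      hence "rot t (F t (Y t)) = lattice_G V \<phi> (rot t (Y t))"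
        by (simp add: F_def cap_norm_id rotating_G_def rot_rot)
      thus ?thesis using has_vector_derivative_rot[OF Y(2)[OF t]] by simp
    qed
    thus "lattice_solution V \<phi> T X0 (\<lambda>t. rot t (Y t))"
      by (simp add: lattice_solution_def Y(1))
  qed
qed

text \<open>
  Both solutions are bounded on the compact time interval, and on a ball the vector field is Lipschitz;
  Gronwall's inequality with defect zero applies after retraction onto this ball.
\<close>

lemma lattice_solution_unique:
  assumes V: "C2 V" "deriv V 0 = 0" and \<phi>: "C2 \<phi>" "deriv \<phi> 0 = 0"
    and X: "lattice_solution V \<phi> T X0 X" and Y: "lattice_solution V \<phi> T X0 Y" and t: "t \<in> {0..T}"
  shows "X t = Y t"
proof -
  define H where "H = (\<lambda>X. lattice_J X + lattice_G V \<phi> X)"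
  have dX: "(X has_vector_derivative H (X t)) (at t within {0..T})"
    and dY: "(Y has_vector_derivative H (Y t)) (at t within {0..T})" if "t \<in> {0..T}" for t
    using X Y that by (auto simp: lattice_solution_def H_def)
  have "bounded (X ` {0..T} \<union> Y ` {0..T})"
    unfolding bounded_Un
    by (intro conjI compact_imp_bounded compact_continuous_image
        continuous_on_vector_derivative[OF dX] continuous_on_vector_derivative[OF dY]) auto
  then obtain r where r: "r > 0" "\<And>x. x \<in> X ` {0..T} \<union> Y ` {0..T} \<Longrightarrow> norm x \<le> r"
    using bounded_pos by metis
  obtain L where L: "L \<ge> 0" "\<And>x y. norm x \<le> r \<Longrightarrow> norm y \<le> r \<Longrightarrow>
    norm (lattice_F V \<phi> x - lattice_F V \<phi> y) \<le> L * norm (x - y)"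
    using lattice_F_locally_lipschitz[OF V \<phi>] by blast
  have lipH: "norm (H x - H y) \<le> (1 + L) * norm (x - y)" if "norm x \<le> r" "norm y \<le> r" for x y
  proof -
    have "norm (lattice_G V \<phi> x - lattice_G V \<phi> y) \<le> L * norm (x - y)"
    proof -
      have "norm (lattice_G V \<phi> x - lattice_G V \<phi> y) = norm (lattice_F V \<phi> (fst x) - lattice_F V \<phi> (fst y))"
        by (simp add: lattice_G_def)
      also have "\<dots> \<le> L * norm (fst x - fst y)"
        using that norm_fst_le_norm[of x] norm_fst_le_norm[of y] by (intro L(2)) auto
      also have "\<dots> \<le> L * norm (x - y)"
        using norm_fst_le_norm[of "x - y"] L(1) by (intro mult_left_mono) (auto simp flip: fst_diff)
      finally show ?thesis .
    qed
    moreover have "H x - H y = lattice_J (x - y) + (lattice_G V \<phi> x - lattice_G V \<phi> y)"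
      by (simp add: H_def lattice_J_def)
    hence "norm (H x - H y) \<le> norm (lattice_J (x - y)) + norm (lattice_G V \<phi> x - lattice_G V \<phi> y)"
      by (simp only: norm_triangle_ineq)
    ultimately show ?thesis by (simp add: distrib_right)
  qed
  have lip: "norm (H (cap_norm r x) - H (cap_norm r y)) \<le> (2 * (1 + L)) * norm (x - y)" for x y
  proof -
    have "norm (H (cap_norm r x) - H (cap_norm r y)) \<le> (1 + L) * norm (cap_norm r x - cap_norm r y)"
      using r(1) by (intro lipH norm_cap_norm) auto
    also have "\<dots> \<le> (1 + L) * (2 * norm (x - y))"
      using r(1) L(1) by (intro mult_left_mono cap_norm_lipschitz) auto
    finally show ?thesis by (simp add: algebra_simps)
  qed
  have cont: "continuous_on S (\<lambda>x. H (cap_norm r x))" for S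
    by (rule continuous_on_norm_lipschitz[OF _ lip]) (use L in auto)
  have "norm (X t - Y t) \<le> (norm (X 0 - Y 0) + 0) * exp (2 * (1 + L) * t)"
  proof (rule perturbed_flow_estimate[where F = "\<lambda>_ x. H (cap_norm r x)" and R = "\<lambda>_. 0", OF _ _ lip _ _ _ _ t])
    show "continuous_on {0..T} (\<lambda>t. H (cap_norm r (u t)))" if "continuous_on {0..T} u" for u
      by (rule continuous_on_compose2[OF cont that]) auto
    show "(X has_vector_derivative H (cap_norm r (X t))) (at t within {0..T})"
      "(Y has_vector_derivative H (cap_norm r (Y t)) - 0) (at t within {0..T})" if "t \<in> {0..T}" for t
    proof -
      have "norm (X t) \<le> r" "norm (Y t) \<le> r" using that by (auto intro!: r(2))
      thus "(X has_vector_derivative H (cap_norm r (X t))) (at t within {0..T})"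
        "(Y has_vector_derivative H (cap_norm r (Y t)) - 0) (at t within {0..T})"
        using dX[OF that] dY[OF that] by (simp_all only: cap_norm_id diff_zero)
    qed
  qed (use L in auto)
  moreover have "X 0 = Y 0" using X Y unfolding lattice_solution_def by metis
  ultimately show ?thesis by simp
qed

section \<open>The time scale and the size of the error\<close>

text \<open>
  Any positive power beats the logarithm; the threshold is explicit because
  \<open>\<bar>ln \<epsilon>\<bar> \<le> (2 / \<kappa>) * \<epsilon> powr (- \<kappa> / 2)\<close>.
\<close>

lemma log_powr_small:
  fixes \<kappa> C :: real
  assumes \<kappa>: "\<kappa> > 0" and C: "C > 0"
  obtains e where "e > 0" "\<And>\<epsilon>. 0 < \<epsilon> \<Longrightarrow> \<epsilon> \<le> e \<Longrightarrow> C * \<bar>ln \<epsilon>\<bar> * \<epsilon> powr \<kappa> \<le> 1"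
proof -
  define e where "e = min 1 ((\<kappa> / (2 * C)) powr (2 / \<kappa>))"
  have small: "C * \<bar>ln \<epsilon>\<bar> * \<epsilon> powr \<kappa> \<le> 1" if \<epsilon>: "0 < \<epsilon>" "\<epsilon> \<le> e" for \<epsilon>
  proof -
    have "\<bar>ln \<epsilon>\<bar> = ln (1 / \<epsilon>)" using \<epsilon> by (simp add: e_def ln_div)
    also have "\<dots> \<le> (1 / \<epsilon>) powr (\<kappa> / 2) / (\<kappa> / 2)"
      using \<epsilon> \<kappa> by (intro ln_powr_bound) (auto simp: e_def)
    also have "\<dots> = 2 / \<kappa> * \<epsilon> powr (- (\<kappa> / 2))"
      using \<epsilon> by (simp add: powr_minus_divide powr_divide)
    finally have "C * \<bar>ln \<epsilon>\<bar> * \<epsilon> powr \<kappa> \<le> C * (2 / \<kappa> * \<epsilon> powr (- (\<kappa> / 2))) * \<epsilon> powr \<kappa>"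
      using C by (intro mult_right_mono mult_left_mono) auto
    also have "\<dots> = 2 * C / \<kappa> * (\<epsilon> powr (- (\<kappa> / 2)) * \<epsilon> powr \<kappa>)" by simp
    also have "\<dots> = 2 * C / \<kappa> * \<epsilon> powr (\<kappa> / 2)" by (simp flip: powr_add)
    also have "\<dots> \<le> 2 * C / \<kappa> * ((\<kappa> / (2 * C)) powr (2 / \<kappa>)) powr (\<kappa> / 2)"
      using \<epsilon> C \<kappa> by (intro mult_left_mono powr_mono2) (auto simp: e_def)
    also have "\<dots> = 1" using C \<kappa> by (simp add: powr_powr)
    finally show ?thesis .
  qed
  show ?thesis using that[of e] small C \<kappa> by (simp add: e_def)
qed

text \<open>
  The time scale is chosen so that \<open>L * T = \<mu> * \<bar>ln \<epsilon>\<bar> / 2\<close>. The Gronwall factor \<open>exp (2 * L * T)\<close> is then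
  \<open>\<epsilon> powr (- \<mu>)\<close>, and each contribution to the defect is at most a constant times
  \<open>\<bar>ln \<epsilon>\<bar> * \<epsilon> powr (1 + \<eta>)\<close>. The bound \<open>\<epsilon> \<le> exp (- 1)\<close> guarantees \<open>\<bar>ln \<epsilon>\<bar> \<ge> 1\<close>, so the contribution
  without a logarithm is covered too; \<open>\<mu> < \<eta>\<close> makes the constant independent of \<open>\<mu>\<close>.
\<close>

lemma shadowing_error_bound:
  fixes \<epsilon> :: real
  assumes \<epsilon>: "0 < \<epsilon>" "\<epsilon> \<le> exp (- 1)" and K0: "K0 > 0" and K1: "K1 \<ge> 0"
    and \<eta>: "\<eta> \<le> \<sigma>" "\<eta> \<le> \<delta>" and \<mu>: "0 < \<mu>" "\<mu> < \<eta>"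
    and a: "a \<le> Ci * \<bar>ln \<epsilon>\<bar> * \<epsilon> powr (1 + \<eta>)"
  defines "T \<equiv> \<mu> * (1 / (2 * K0)) * \<bar>ln \<epsilon>\<bar> * \<epsilon> powr (- \<sigma>)"
    and "L \<equiv> K0 * \<epsilon> powr \<sigma>" and "D \<equiv> K1 * \<epsilon> powr (\<sigma> + \<delta>) * \<epsilon>"
  shows "(a + (4*pi * L * \<epsilon> + 4*pi * L\<^sup>2 * \<epsilon> * T + D * T)) * exp (2 * L * T)
    \<le> (Ci + (4*pi * K0 + 2*pi * K0 * \<eta> + K1 * \<eta> / (2 * K0))) * \<bar>ln \<epsilon>\<bar> * \<epsilon> powr (1 + \<eta> - \<mu>)"
proof -
  define l where "l = \<bar>ln \<epsilon>\<bar>"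
  have "ln \<epsilon> \<le> - 1" using ln_mono[OF \<epsilon>(2) \<epsilon>(1)] by simp
  hence l: "l \<ge> 1" "ln \<epsilon> = - l" by (auto simp: l_def)
  have \<epsilon>1: "\<epsilon> \<le> 1" using \<epsilon>(2) by (rule order_trans) simp
  have cancel: "\<epsilon> powr \<sigma> * \<epsilon> powr (- \<sigma>) = 1" using \<epsilon> by (simp flip: powr_add)
  have LT: "L * T = \<mu> * l / 2"
  proof -
    have "L * T = (K0 / K0) * (\<epsilon> powr \<sigma> * \<epsilon> powr (- \<sigma>)) * (\<mu> * l / 2)"
      by (simp add: L_def T_def l_def)
    thus ?thesis using K0 by (simp add: cancel)
  qed
  have exp: "exp (2 * L * T) = \<epsilon> powr (- \<mu>)"
    using \<epsilon> LT l(2) by (simp add: powr_def mult.assoc)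
  have pw: "\<epsilon> powr q * \<epsilon> \<le> \<epsilon> powr (1 + \<eta>)" if "\<eta> \<le> q" for q
  proof -
    have "\<epsilon> powr q * \<epsilon> = \<epsilon> powr (1 + q)" using \<epsilon> by (simp add: powr_add)
    also have "\<dots> \<le> \<epsilon> powr (1 + \<eta>)" using \<epsilon> \<epsilon>1 that by (intro powr_mono') auto
    finally show ?thesis .
  qed
  let ?E = "l * \<epsilon> powr (1 + \<eta>)"
  have E1: "\<epsilon> powr (1 + \<eta>) \<le> ?E" using l(1) mult_right_mono[of 1 l "\<epsilon> powr (1 + \<eta>)"] by simp
  have 1: "4*pi * L * \<epsilon> \<le> 4*pi * K0 * ?E"
  proof -
    have "4*pi * L * \<epsilon> = 4*pi * K0 * (\<epsilon> powr \<sigma> * \<epsilon>)" by (simp add: L_def)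
    also have "\<dots> \<le> 4*pi * K0 * ?E"
      using K0 order_trans[OF pw[OF \<eta>(1)] E1] by (intro mult_left_mono) auto
    finally show ?thesis .
  qed
  have 2: "4*pi * L\<^sup>2 * \<epsilon> * T \<le> 2*pi * K0 * \<eta> * ?E"
  proof -
    have "4*pi * L\<^sup>2 * \<epsilon> * T = 4*pi * (L * \<epsilon>) * (L * T)" by (simp add: power2_eq_square)
    also have "\<dots> = (2*pi * K0) * (\<mu> * (l * (\<epsilon> powr \<sigma> * \<epsilon>)))" unfolding LT by (simp add: L_def)
    also have "\<dots> \<le> (2*pi * K0) * (\<eta> * ?E)"
      using K0 \<mu> l(1) \<epsilon>(1) pw[OF \<eta>(1)] by (intro mult_left_mono mult_mono) auto
    finally show ?thesis by (simp add: mult.assoc)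
  qed
  have 3: "D * T \<le> K1 * \<eta> / (2 * K0) * ?E"
  proof -
    have "D * T = K1 / (2 * K0) * (\<mu> * (l * (\<epsilon> powr (\<sigma> + \<delta>) * \<epsilon> powr (- \<sigma>) * \<epsilon>)))"
      by (simp add: D_def T_def l_def)
    also have "\<epsilon> powr (\<sigma> + \<delta>) * \<epsilon> powr (- \<sigma>) = \<epsilon> powr \<delta>" by (simp flip: powr_add)
    also have "K1 / (2 * K0) * (\<mu> * (l * (\<epsilon> powr \<delta> * \<epsilon>))) \<le> K1 / (2 * K0) * (\<eta> * ?E)"
      using K0 K1 \<mu> l(1) \<epsilon>(1) pw[OF \<eta>(2)] by (intro mult_left_mono mult_mono) auto
    finally show ?thesis by simp
  qed
  have "a + (4*pi * L * \<epsilon> + 4*pi * L\<^sup>2 * \<epsilon> * T + D * T)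
      \<le> Ci * ?E + (4*pi * K0 * ?E + 2*pi * K0 * \<eta> * ?E + K1 * \<eta> / (2 * K0) * ?E)"
    by (intro add_mono 1 2 3) (use a in \<open>simp add: l_def mult.assoc\<close>)
  also have "\<dots> = (Ci + (4*pi * K0 + 2*pi * K0 * \<eta> + K1 * \<eta> / (2 * K0))) * ?E"
    by (simp only: distrib_right)
  finally have "(a + (4*pi * L * \<epsilon> + 4*pi * L\<^sup>2 * \<epsilon> * T + D * T)) * exp (2 * L * T)
      \<le> (Ci + (4*pi * K0 + 2*pi * K0 * \<eta> + K1 * \<eta> / (2 * K0))) * ?E * exp (2 * L * T)"
    by (intro mult_right_mono) auto
  also have "\<dots> = (Ci + (4*pi * K0 + 2*pi * K0 * \<eta> + K1 * \<eta> / (2 * K0))) * l * (\<epsilon> powr (1 + \<eta>) * \<epsilon> powr (- \<mu>))"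
    unfolding exp by (simp only: mult.assoc)
  also have "\<epsilon> powr (1 + \<eta>) * \<epsilon> powr (- \<mu>) = \<epsilon> powr (1 + \<eta> - \<mu>)"
    by (simp flip: powr_add)
  finally show ?thesis by (simp only: l_def)
qed

theorem theorem2p21:
  fixes \<alpha> \<beta> \<gamma> km kp :: real and V W \<phi> :: "real \<Rightarrow> real"
  defines "\<eta> \<equiv> min (\<alpha> - 1) (min \<beta> \<gamma>)"
  assumes "\<alpha> > 1" and "(km, kp) \<noteq> (0, 0)" and "\<beta> > 0" and "\<gamma> > 0"
    and "C2 V" and "\<And>r. V r = V_hom \<alpha> km kp r + W r"
    and "deriv W 0 = 0"
    and "deriv (deriv W) \<in> O[at 0](\<lambda>r. \<bar>r\<bar> powr (\<alpha> - 1 + \<beta>))"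
    and "C2 \<phi>" and "deriv \<phi> 0 = 0"
    and "deriv (deriv \<phi>) \<in> O[at 0](\<lambda>x. \<bar>x\<bar> powr (\<alpha> - 1 + \<gamma>))"
  shows "\<exists>\<nu>>0. \<forall>Ci>0. \<exists>Cl>0. \<forall>\<mu>. 0 < \<mu> \<and> \<mu> < \<eta> \<longrightarrow> (\<exists>\<epsilon>0>0.
    \<forall>xs ys :: real ell2. \<forall>\<epsilon>. \<epsilon> = norm (xs, ys) \<and> 0 < \<epsilon> \<and> \<epsilon> \<le> \<epsilon>0 \<longrightarrow>
      (\<forall>A. amplitude_solution \<alpha> km kp A \<and>
           (\<forall>n. ell2_nth (A 0) n =
              (complex_of_real (ell2_nth xs n) - \<i> * complex_of_real (ell2_nth ys n)) / complex_of_real (sqrt 2)) \<longrightarrow>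
        (\<forall>X0. norm (X0 - (xs, ys)) \<le> Ci * \<bar>ln \<epsilon>\<bar> * \<epsilon> powr (1 + \<eta>) \<longrightarrow>
          (let T = \<mu> * \<nu> * \<bar>ln \<epsilon>\<bar> * \<epsilon> powr (1 - \<alpha>) in
            \<exists>X. lattice_solution V \<phi> T X0 X \<and>
                (\<forall>Y. lattice_solution V \<phi> T X0 Y \<longrightarrow> (\<forall>t\<in>{0..T}. Y t = X t)) \<and>
                (\<forall>t\<in>{0..T}. norm (X t - X_approx A t) \<le> Cl * \<bar>ln \<epsilon>\<bar> * \<epsilon> powr (1 + \<eta> - \<mu>))))))"
proof -
  note \<alpha> = \<open>\<alpha> > 1\<close>
  have V: "C2 V" "deriv V 0 = 0" and \<phi>: "C2 \<phi>" "deriv \<phi> 0 = 0"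
    using assms deriv_potential_0[OF \<alpha> \<open>C2 V\<close>] by auto
  note W = correction_potential[OF \<alpha> V \<phi> assms(7,8)]
  obtain C d where C: "C > 0" and d: "d > 0" and bounds:
    "\<And>r. \<bar>r\<bar> \<le> d \<Longrightarrow> \<bar>deriv (deriv V) r\<bar> \<le> C * \<bar>r\<bar> powr (\<alpha> - 1)"
    "\<And>r. \<bar>r\<bar> \<le> d \<Longrightarrow> \<bar>stiffness_hom \<alpha> km kp r\<bar> \<le> C * \<bar>r\<bar> powr (\<alpha> - 1)"
    "\<And>r. \<bar>r\<bar> \<le> d \<Longrightarrow> \<bar>deriv (deriv \<phi>) r\<bar> \<le> C * \<bar>r\<bar> powr (\<alpha> - 1)"
    "\<And>r. \<bar>r\<bar> \<le> d \<Longrightarrow> \<bar>deriv (deriv W) r\<bar> \<le> C * \<bar>r\<bar> powr (\<alpha> - 1 + min \<beta> \<gamma>)"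
    "\<And>r. \<bar>r\<bar> \<le> d \<Longrightarrow> \<bar>deriv (deriv \<phi>) r\<bar> \<le> C * \<bar>r\<bar> powr (\<alpha> - 1 + min \<beta> \<gamma>)"
    using model_bounds[OF \<alpha> \<open>\<beta> > 0\<close> \<open>\<gamma> > 0\<close> V \<phi> assms(7,8,9) assms(12)] by metis
  define \<sigma> where "\<sigma> = \<alpha> - 1"
  define \<delta> where "\<delta> = min \<beta> \<gamma>"
  have pos: "\<sigma> > 0" "\<delta> > 0" "\<eta> > 0" "\<eta> \<le> \<sigma>" "\<eta> \<le> \<delta>"
    using assms by (auto simp: \<sigma>_def \<delta>_def \<eta>_def)
  \<comment> \<open>\<open>K0\<close> is the Lipschitz factor on the ball of radius \<open>2 * \<epsilon>\<close>, \<open>K1\<close> the size factor of the corrections on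
    the ball of radius \<open>\<epsilon>\<close>; the differences along bonds double both radii.\<close>
  define K0 where "K0 = 5 * C * 4 powr \<sigma>"
  define K1 where "K1 = 5 * C * 2 powr (\<sigma> + \<delta>)"
  have K: "K0 > 0" "K1 > 0" using C by (auto simp: K0_def K1_def)
  define \<nu> where "\<nu> = 1 / (2 * K0)"
  define C' where "C' = 4*pi * K0 + 2*pi * K0 * \<eta> + K1 * \<eta> / (2 * K0)"
  have C': "C' > 0" using K pos by (auto simp: C'_def intro!: add_pos_pos)
  show ?thesis
  proof (rule exI[of _ \<nu>], intro conjI allI impI, goal_cases)
    case 1
    show ?case using K by (simp add: \<nu>_def)
  next
    case (2 Ci)
    define Cl where "Cl = Ci + C'"
    have Cl: "Cl > 0" using 2 C' by (simp add: Cl_def)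
    show ?case
    proof (rule exI[of _ Cl], intro conjI allI impI Cl, goal_cases)
      case (1 \<mu>)
      hence \<mu>: "0 < \<mu>" "\<mu> < \<eta>" by auto
      obtain e where e: "e > 0" "\<And>\<epsilon>. 0 < \<epsilon> \<Longrightarrow> \<epsilon> \<le> e \<Longrightarrow> Cl * \<bar>ln \<epsilon>\<bar> * \<epsilon> powr (\<eta> - \<mu>) \<le> 1"
        using log_powr_small[of "\<eta> - \<mu>" Cl] \<mu> Cl by auto
      \<comment> \<open>The three thresholds: the error stays below \<open>\<epsilon>\<close>, the bounds on second derivatives cover all bonds in
        the ball of radius \<open>2 * \<epsilon>\<close>, and \<open>\<bar>ln \<epsilon>\<bar> \<ge> 1\<close>.\<close>
      define \<epsilon>0 where "\<epsilon>0 = min e (min (d / 4) (exp (- 1)))"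
      have \<epsilon>0: "\<epsilon>0 > 0" using e d by (simp add: \<epsilon>0_def)
      show ?case
      proof (rule exI[of _ \<epsilon>0], intro conjI allI impI \<epsilon>0, goal_cases)
        case (1 xs ys \<epsilon> A X0)
        hence \<epsilon>: "\<epsilon> = norm (xs, ys)" "0 < \<epsilon>" "\<epsilon> \<le> \<epsilon>0" and A: "amplitude_solution \<alpha> km kp A"
          and A0: "\<And>n. ell2_nth (A 0) n =
            (complex_of_real (ell2_nth xs n) - \<i> * complex_of_real (ell2_nth ys n)) / complex_of_real (sqrt 2)"
          and X0: "norm (X0 - (xs, ys)) \<le> Ci * \<bar>ln \<epsilon>\<bar> * \<epsilon> powr (1 + \<eta>)"
          by blast+
        define T where "T = \<mu> * \<nu> * \<bar>ln \<epsilon>\<bar> * \<epsilon> powr (1 - \<alpha>)"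
        have \<epsilon>': "\<epsilon> \<le> e" "4 * \<epsilon> \<le> d" "\<epsilon> \<le> exp (- 1)" using \<epsilon>(3) by (auto simp: \<epsilon>0_def)
        have T: "T \<ge> 0" using \<mu> K by (simp add: T_def \<nu>_def)
        define L where "L = K0 * \<epsilon> powr \<sigma>"
        define D where "D = K1 * \<epsilon> powr (\<sigma> + \<delta>) * \<epsilon>"
        have LD: "L \<ge> 0" "D \<ge> 0" using K \<epsilon>(2) by (auto simp: L_def D_def)
        have L_eq: "5 * C * (2 * (2 * \<epsilon>)) powr (\<alpha> - 1) = L"
          using \<epsilon>(2) by (simp add: L_def K0_def \<sigma>_def powr_mult)
        obtain A' where A': "\<And>t. (A has_vector_derivative A' t) (at t)"
          "\<And>t. cscale \<i> (A' t) = delta_plus (amplitude_f \<alpha> km kp (delta_minus (A t)))"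
          using amplitude_derivative[OF A \<alpha>] by blast
        define P where "P = (\<lambda>t. demod (A t))"
        have P0: "P 0 = (xs, ys)"
          by (auto simp: P_def prod_eq_iff ell2_nth_demod A0 Re_divide_of_real Im_divide_of_real intro!: ell2_eqI)
        have normP: "norm (P t) = \<epsilon>" for t
        proof -
          have "norm (P t) = norm (P 0)"
            using amplitude_norm_conserved[OF A \<alpha>, of t] by (simp add: P_def norm_demod)
          thus ?thesis by (simp add: P0 \<epsilon>(1))
        qed
        have dP: "(P has_vector_derivative averaged_G \<alpha> km kp (P t)) (at t within {0..T})" for t
        proof -
          have "(P has_vector_derivative demod (A' t)) (at t within {0..T})"
            unfolding P_def
            by (intro bounded_linear.has_vector_derivative[OF bounded_linear_demod]
                has_vector_derivative_at_within[OF A'(1)])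
          thus ?thesis using demod_amplitude_derivative[OF \<alpha> A'(2)] by (simp add: P_def)
        qed
        define err where "err = (norm (X0 - P 0) + (4*pi * L * \<epsilon> + 4*pi * L\<^sup>2 * \<epsilon> * T + D * T)) * exp (2 * L * T)"
        have "err \<le> (Ci + (4*pi * K0 + 2*pi * K0 * \<eta> + K1 * \<eta> / (2 * K0))) * \<bar>ln \<epsilon>\<bar> * \<epsilon> powr (1 + \<eta> - \<mu>)"
          using shadowing_error_bound[OF \<epsilon>(2) \<epsilon>'(3) K(1) less_imp_le[OF K(2)] pos(4,5) \<mu> X0]
          unfolding err_def P0 T_def L_def D_def \<nu>_def \<sigma>_def by (simp only: minus_diff_eq)
        hence err: "err \<le> Cl * \<bar>ln \<epsilon>\<bar> * \<epsilon> powr (1 + \<eta> - \<mu>)" by (simp only: Cl_def C'_def)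
        also have "\<dots> = \<epsilon> * (Cl * \<bar>ln \<epsilon>\<bar> * \<epsilon> powr (\<eta> - \<mu>))"
          using \<epsilon>(2) by (simp add: powr_add powr_diff)
        also have "\<dots> \<le> \<epsilon>" using e(2)[OF \<epsilon>(2) \<epsilon>'(1)] \<epsilon>(2) by (simp add: mult_left_le)
        finally have small: "err \<le> \<epsilon>" .
        have lipV: "norm (lattice_F V \<phi> x - lattice_F V \<phi> y) \<le> L * norm (x - y)"
          if "norm x \<le> 2 * \<epsilon>" "norm y \<le> 2 * \<epsilon>" for x y
          using lattice_F_powr_lipschitz[OF V \<phi> less_imp_le[OF C] _ bounds(1,3) _ that] \<epsilon>' \<alpha>
          unfolding L_eq by simp
        have lipH: "norm (lattice_F (V_hom \<alpha> km kp) (\<lambda>_. 0) x - lattice_F (V_hom \<alpha> km kp) (\<lambda>_. 0) y) \<le> L * norm (x - y)"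
          if "norm x \<le> \<epsilon>" "norm y \<le> \<epsilon>" for x y
        proof -
          have "norm (lattice_F (V_hom \<alpha> km kp) (\<lambda>_. 0) x - lattice_F (V_hom \<alpha> km kp) (\<lambda>_. 0) y)
              \<le> 5 * C * (2 * (2 * \<epsilon>)) powr (\<alpha> - 1) * norm (x - y)"
            using \<epsilon>' \<epsilon>(2) \<alpha> C that
            by (intro lattice_F_powr_lipschitz[OF model_hom[OF \<alpha>], where d = d])
              (simp_all add: deriv_V_hom deriv_force_hom bounds(2))
          thus ?thesis unfolding L_eq .
        qed
        have rem: "norm (lattice_F V \<phi> x - lattice_F (V_hom \<alpha> km kp) (\<lambda>_. 0) x) \<le> D" if x: "norm x \<le> \<epsilon>" for x
        proof -
          have "norm (lattice_F W \<phi> x - lattice_F W \<phi> 0)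
              \<le> 5 * C * (2 * \<epsilon>) powr (\<alpha> - 1 + min \<beta> \<gamma>) * norm (x - 0)"
            using \<epsilon>' \<epsilon>(2) pos C x
            by (intro lattice_F_powr_lipschitz[OF W(1) assms(8) \<phi> _ _ bounds(4,5)])
              (auto simp: \<sigma>_def \<delta>_def)
          also have "\<dots> = K1 * \<epsilon> powr (\<sigma> + \<delta>) * norm x"
            using \<epsilon>(2) by (simp add: K1_def \<sigma>_def \<delta>_def powr_mult)
          also have "\<dots> \<le> D" unfolding D_def using x K by (intro mult_left_mono) auto
          finally show ?thesis
            unfolding W(3) lattice_F_zero[OF W(1) assms(8) \<phi>] by simp
        qed
        obtain X where X: "lattice_solution V \<phi> T X0 X" "\<And>t. t \<in> {0..T} \<Longrightarrow> norm (X t - rot t (P t)) \<le> err"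
          using lattice_shadows_averaged[OF \<alpha> V \<phi> less_imp_le[OF \<epsilon>(2)] T LD lipV lipH rem dP eq_refl[OF normP]
              small[unfolded err_def]]
          unfolding err_def by metis
        have "\<forall>t\<in>{0..T}. norm (X t - X_approx A t) \<le> Cl * \<bar>ln \<epsilon>\<bar> * \<epsilon> powr (1 + \<eta> - \<mu>)"
          using X(2) err unfolding X_approx_eq_rot P_def by (meson order_trans)
        moreover have "\<forall>Y. lattice_solution V \<phi> T X0 Y \<longrightarrow> (\<forall>t\<in>{0..T}. Y t = X t)"
          using lattice_solution_unique[OF V \<phi> _ X(1)] by blast
        ultimately show ?case
          using X(1) unfolding Let_def T_def[symmetric] by blast
      qed
    qed
  qed
qed

end
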